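(* Let $R$ be a consistent triple set and let $\mathbb{F}_R=\{R''\subseteq R' : R'\in \min(\mathfrak{sc}(R))\}$. Then $(R,\mathbb{F}_R)$ is a matroid (and its collection of bases is $\min(\mathfrak{sc}(R))$).
   Context: Rooted trees: a rooted tree $T$ has a distinguished inner vertex $\rho_T$ (the root); leaves are the vertices of degree 1; every inner vertex other than the root has degree at least 3. A triple $ab|c$ is the rooted binary tree on three leaves $a,b,c$ in which the path from $a$ to $b$ does not meet the path from $c$ to the root; $ab|c$ and $ba|c$ are not distinguished. A rooted tree $T$ displays $ab|c$ if $a,b,c$ are leaves of $T$ and the path from $a$ to $b$ does not intersect the path from $c$ to $\rho_T$. $\mathcal R(T)$ is the set of triples displayed by $T$. A set $R$ of triples is consistent if some rooted tree displays every triple in $R$. $L_R$ is the set of all leaves occurring in triples of $R$. $\mathrm{span}(R)$ is the set of rooted trees with leaf set $L_R$ that display all triples of $R$, and the closure is $\mathrm{cl}(R)=\bigcap_{T\in\mathrm{span}(R)}\mathcal R(T)$. A subset $R'\subseteq R$ is representative for $R$ if $\mathrm{cl}(R')=\mathrm{cl}(R)$; $\mathfrak{sc}(R)$ is the set of all representative subsets of $R$, and $\min(\mathfrak{sc}(R))$ is the set of those that are minimal with respect to inclusion. A matroid is a pair $(E,\mathbb F)$ with $E$ finite and $\mathbb F$ a family of subsets of $E$ such that $\emptyset\in\mathbb F$, $\mathbb F$ is closed under taking subsets, and whenever $I_1,I_2\in\mathbb F$ with $|I_1|<|I_2|$ there is $x\in I_2\setminus I_1$ with $I_1\cup\{x\}\in\mathbb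 F$; its bases are its maximal independent sets. *)

theory Defs
  imports "HOL-Library.Infinite_Typeclass" "Graph_Theory.Graph_Theory"
begin

section \<open>Rooted trees\<close>

text \<open>
  A simple undirected graph is a loop-free symmetric digraph without parallel arcs
  (\<^locale>\<open>pair_graph\<close>, which includes finiteness), so every edge is present as two arcs.
  The constant \<^const>\<open>tree\<close> of the graph library is of no use here: it forbids all directed
  cycles, including the closed walk of length 2 along a single edge. Undirected cycles are the
  directed cycles of length at least 3.
\<close>

definition undirected_tree :: "'v pair_pre_digraph \<Rightarrow> bool" where
  "undirected_tree G \<longleftrightarrow>
     pair_graph G \<and> connected (with_proj G) \<and>
     \<not> (\<exists>p. pre_digraph.cycle (with_proj G) p \<and> 3 \<le> length p)"

definition vertex_degree :: "'v pair_pre_digraph \<Rightarrow> 'v \<Rightarrow> nat" where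
  "vertex_degree G v = out_degree (with_proj G) v"

definition tree_leaves :: "'v pair_pre_digraph \<Rightarrow> 'v set" where
  "tree_leaves G = {v \<in> pverts G. vertex_degree G v = 1}"

definition inner_vertices :: "'v pair_pre_digraph \<Rightarrow> 'v set" where
  "inner_vertices G = pverts G - tree_leaves G"

text \<open>
  A rooted graph is a pair of a graph and its root. A tree consisting of its root alone is a
  rooted tree without leaves; such trees form the span of the empty triple set.
\<close>

type_synonym 'v rooted = "'v pair_pre_digraph \<times> 'v"

definition rooted_tree :: "'v rooted \<Rightarrow> bool" where
  "rooted_tree T \<longleftrightarrow> (case T of (G, \<rho>) \<Rightarrow>
     undirected_tree G \<and> \<rho> \<in> inner_vertices G \<and>
     (\<forall>v \<in> inner_vertices G - {\<rho>}. 3 \<le> vertex_degree G v))"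

section \<open>Triples\<close>

text \<open>
  The triple \<open>ab|c\<close> is encoded as \<open>({a, b}, c)\<close>, which identifies \<open>ab|c\<close> and \<open>ba|c\<close>.
  Pairs that do not come from three distinct leaves are not displayed by any tree and hence do
  not occur in a consistent set.
\<close>

type_synonym 'v triple = "'v set \<times> 'v"

definition triple :: "'v \<Rightarrow> 'v \<Rightarrow> 'v \<Rightarrow> 'v triple" where
  "triple a b c = ({a, b}, c)"

definition triple_leaves :: "'v triple \<Rightarrow> 'v set" where
  "triple_leaves t = insert (snd t) (fst t)"

text \<open>
  Paths are unique in trees, so it is immaterial whether the two paths are quantified
  existentially or universally.
\<close>

definition displays :: "'v rooted \<Rightarrow> 'v triple \<Rightarrow> bool" where
  "displays T t \<longleftrightarrow> (case T of (G, \<rho>) \<Rightarrow>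
     \<exists>a b c. t = triple a b c \<and> distinct [a, b, c] \<and>
       a \<in> tree_leaves G \<and> b \<in> tree_leaves G \<and> c \<in> tree_leaves G \<and>
       (\<exists>p q. pre_digraph.apath (with_proj G) a p b \<and>
              pre_digraph.apath (with_proj G) c q \<rho> \<and>
              set (pre_digraph.awalk_verts (with_proj G) a p) \<inter>
              set (pre_digraph.awalk_verts (with_proj G) c q) = {}))"

definition displayed_triples :: "'v rooted \<Rightarrow> 'v triple set" where
  "displayed_triples T = {t. displays T t}"

definition consistent :: "'v triple set \<Rightarrow> bool" where
  "consistent R \<longleftrightarrow> (\<exists>T. rooted_tree T \<and> (\<forall>t\<in>R. displays T t))"

definition leaf_set :: "'v triple set \<Rightarrow> 'v set" where
  "leaf_set R = (\<Union>t\<in>R. triple_leaves t)"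

section \<open>Closure and representative subsets\<close>

text \<open>
  The trees in the span have their vertices in the type of the leaf labels. The theorem takes that
  type to be infinite, so that inner vertices are never in short supply and, up to isomorphism
  fixing the leaves, all rooted trees on the given leaf set occur.
\<close>

definition triple_span :: "'v triple set \<Rightarrow> 'v rooted set" where
  "triple_span R = {T. rooted_tree T \<and> tree_leaves (fst T) = leaf_set R \<and> (\<forall>t\<in>R. displays T t)}"

definition cl :: "'v triple set \<Rightarrow> 'v triple set" where
  "cl R = (\<Inter>T\<in>triple_span R. displayed_triples T)"

definition representative :: "'v triple set \<Rightarrow> 'v triple set \<Rightarrow> bool" where
  "representative R' R \<longleftrightarrow> R' \<subseteq> R \<and> cl R' = cl R"

definition sc :: "'v triple set \<Rightarrow> 'v triple set set" where
  "sc R = {R'. representative R' R}"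

definition min_sc :: "'v triple set \<Rightarrow> 'v triple set set" where
  "min_sc R = {R' \<in> sc R. \<not> (\<exists>R''\<in>sc R. R'' \<subset> R')}"

definition rep_indep_sets :: "'v triple set \<Rightarrow> 'v triple set set" where
  "rep_indep_sets R = {R''. \<exists>R'\<in>min_sc R. R'' \<subseteq> R'}"

text \<open>Trees are finite, so finiteness of a consistent set is no separate assumption:\<close>

lemma consistent_imp_finite:
  assumes "consistent R"
  shows "finite R"
proof -
  obtain G \<rho> where T: "rooted_tree (G, \<rho>)" and R: "\<forall>t\<in>R. displays (G, \<rho>) t"
    using assms by (auto simp: consistent_def)
  have "finite (pverts G)"
    using T by (auto simp: rooted_tree_def undirected_tree_def pair_graph_def pair_digraph_def
        pair_fin_digraph_def pair_fin_digraph_axioms_def)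
  moreover have "R \<subseteq> Pow (pverts G) \<times> pverts G"
    using R by (fastforce simp: displays_def triple_def tree_leaves_def)
  ultimately show ?thesis
    by (meson finite_Pow_iff finite_SigmaI finite_subset)
qed

section \<open>Matroids\<close>

locale matroid =
  fixes E :: "'a set" and F :: "'a set set"
  assumes finite_ground: "finite E"
    and indep_subset_ground: "I \<in> F \<Longrightarrow> I \<subseteq> E"
    and empty_indep: "{} \<in> F"
    and subset_indep: "I \<in> F \<Longrightarrow> J \<subseteq> I \<Longrightarrow> J \<in> F"
    and augmentation:
      "I1 \<in> F \<Longrightarrow> I2 \<in> F \<Longrightarrow> card I1 < card I2 \<Longrightarrow> \<exists>x \<in> I2 - I1. I1 \<union> {x} \<in> F"

definition bases :: "'a set set \<Rightarrow> 'a set set" where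
  "bases F = {B \<in> F. \<not> (\<exists>I\<in>F. B \<subset> I)}"

end

(*
  The closure is described by Aho graphs: xy|z lies in cl S iff some leaf set L has an Aho graph
  [S, L] with exactly two components, one containing x and y, the other z (Bryant and Steel).
  Minimal generating sets then satisfy basis exchange. Let X be a minimal representative set,
  b = xy|z in X, and let Y be representative without b. If no n in Y made X - b + n representative,
  then every edge pq|r of the Aho graph that derives b from Y could be replaced by a path in some
  Aho graph of X - b, and gluing those graphs together would derive b from X - b, contradicting
  minimality. Exchange gives equal cardinalities, hence a matroid.
*)
theory Submission
  imports Defs
begin

section \<open>Matroids from generating sets\<close>

text \<open>Equality of closures compares intersections over all trees on a leaf set and gives no
  direct handle on exchange. For consistent \<open>R\<close> and \<open>S \<subseteq> R\<close> it
  reduces to \<open>R \<subseteq> inferred S\<close>, which is monotone in \<open>S\<close> and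
  mentions no tree. The reduction needs trees twice: displayed triples are read off the branches at
  a last common ancestor, and a triple that is not inferred has to be refuted by an actual tree.
  That tree displays one of the two competing triples on the same three leaves and is built by
  splitting along Aho components. The exchange rests on the consistency of all of \<open>R\<close>:
  no set with at least two elements has a connected Aho graph. This excludes the one case in which
  the edge pq depends on b although pq|r cannot replace b.\<close>

locale generating_exchange =
  fixes R :: "'a set" and Gen :: "'a set \<Rightarrow> bool"
  assumes finite_R: "finite R"
    and Gen_R: "Gen R"
    and Gen_mono: "Gen X \<Longrightarrow> X \<subseteq> Y \<Longrightarrow> Y \<subseteq> R \<Longrightarrow> Gen Y"
    and Gen_exchange: "X \<subseteq> R \<Longrightarrow> Y \<subseteq> R \<Longrightarrow> Gen X \<Longrightarrow> Gen Y \<Longrightarrow> b \<in> X - Y \<Longrightarrow> \<not> Gen (X - {b}) \<Longrightarrow>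
      \<exists>n\<in>Y - X. Gen (insert n (X - {b}))"
begin

section \<open>Minimal generating sets: equal size, basis exchange, augmentation\<close>

definition min_gen :: "'a set \<Rightarrow> bool" where
  "min_gen B \<longleftrightarrow> B \<subseteq> R \<and> Gen B \<and> (\<forall>X. X \<subset> B \<longrightarrow> \<not> Gen X)"

lemma min_gen_subset: "min_gen B \<Longrightarrow> B \<subseteq> R"
  by (simp add: min_gen_def)

lemma min_gen_finite: "min_gen B \<Longrightarrow> finite B"
  using finite_R finite_subset min_gen_subset by blast

lemma ex_min_gen_subset:
  assumes "Gen X" "X \<subseteq> R"
  shows "\<exists>B. B \<subseteq> X \<and> min_gen B"
proof -
  have "finite X" using assms(2) finite_R finite_subset by blast
  then show ?thesis using assms
  proof (induction X rule: finite_psubset_induct)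
    case (psubset X)
    show ?case
    proof (cases "\<exists>Y. Y \<subset> X \<and> Gen Y")
      case True
      then obtain Y where "Y \<subset> X" "Gen Y" by blast
      then show ?thesis using psubset.IH[of Y] psubset.prems by blast
    next
      case False
      then show ?thesis using psubset.prems unfolding min_gen_def by blast
    qed
  qed
qed

text \<open>\<open>Y\<close> need not be minimal, and the exchanged set only generates. That it is
  minimal too can be seen only once all minimal sets are known to have the same size.\<close>

lemma min_gen_exchange:
  assumes "min_gen B" "Y \<subseteq> R" "Gen Y" "b \<in> B - Y"
  shows "\<exists>n\<in>Y - B. Gen (insert n (B - {b}))"
proof (rule Gen_exchange)
  show "\<not> Gen (B - {b})" using assms(1,4) unfolding min_gen_def by blast
qed (use assms in \<open>auto simp: min_gen_def\<close>)

text \<open>Exchanging an element outside \<open>B'\<close> for one of \<open>B'\<close> and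
  shrinking to a minimal set makes the part outside \<open>B'\<close> strictly smaller and never
  increases the size. When no such element is left, minimality gives \<open>B = B'\<close>.\<close>

lemma card_le_min_gen:
  assumes "min_gen B" "min_gen B'"
  shows "card B' \<le> card B"
  using assms(1)
proof (induction "card (B - B')" arbitrary: B rule: less_induct)
  case less
  show ?case
  proof (cases "B \<subseteq> B'")
    case True
    then have "B = B'" using less.prems assms(2) unfolding min_gen_def by blast
    then show ?thesis by simp
  next
    case False
    then obtain b where b: "b \<in> B - B'" by blast
    then obtain n where n: "n \<in> B' - B" "Gen (insert n (B - {b}))"
      using min_gen_exchange[OF less.prems _ _ b] assms(2) by (auto simp: min_gen_def)
    have "insert n (B - {b}) \<subseteq> R"
      using n(1) min_gen_subset[OF assms(2)] min_gen_subset[OF less.prems] by blast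
    then obtain D where D: "D \<subseteq> insert n (B - {b})" "min_gen D"
      using ex_min_gen_subset[OF n(2)] by blast
    have fin: "finite B" using less.prems by (rule min_gen_finite)
    have "D - B' \<subset> B - B'" using D(1) n(1) b by blast
    then have "card (D - B') < card (B - B')" using fin by (simp add: psubset_card_mono)
    then have "card B' \<le> card D" using less.hyps D(2) by blast
    also have "\<dots> \<le> card (insert n (B - {b}))" using D(1) fin by (simp add: card_mono)
    also have "\<dots> = card B"
      using n(1) b fin by (metis Diff_iff card.remove card_insert_disjoint finite_Diff)
    finally show ?thesis .
  qed
qed

text \<open>A minimal set inside the exchanged set is as large as \<open>B\<close>, so nothing was
  dropped from it.\<close>

lemma min_gen_basis_exchange:
  assumes "min_gen B" "min_gen B'" "b \<in> B - B'"
  shows "\<exists>n\<in>B' - B. min_gen (insert n (B - {b}))"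
proof -
  obtain n where n: "n \<in> B' - B" "Gen (insert n (B - {b}))"
    using min_gen_exchange[OF assms(1) _ _ assms(3)] assms(2) by (auto simp: min_gen_def)
  have "insert n (B - {b}) \<subseteq> R"
    using n(1) min_gen_subset[OF assms(1)] min_gen_subset[OF assms(2)] by blast
  then obtain D where D: "D \<subseteq> insert n (B - {b})" "min_gen D"
    using ex_min_gen_subset[OF n(2)] by blast
  have fin: "finite B" using assms(1) by (rule min_gen_finite)
  have "card (insert n (B - {b})) = card B"
    using n(1) assms(3) fin by (metis Diff_iff card.remove card_insert_disjoint finite_Diff)
  also have "\<dots> \<le> card D" using card_le_min_gen D(2) assms(1) by blast
  finally have "D = insert n (B - {b})"
    using D(1) fin by (meson card_seteq finite.insertI finite_Diff)
  then show ?thesis using D(2) n(1) by blast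
qed

text \<open>Take \<open>B1\<close> around \<open>I1\<close> as close to \<open>B2\<close> as
  possible. If \<open>I1\<close> cannot be augmented, \<open>B1 - I1\<close> fits into
  \<open>B2 - I2\<close>, which is smaller because \<open>B1\<close> and \<open>B2\<close> have the
  same size.\<close>

lemma matroid_min_gen: "matroid R {I. \<exists>B. min_gen B \<and> I \<subseteq> B}"
proof
  show "finite R" by (rule finite_R)
next
  show "{} \<in> {I. \<exists>B. min_gen B \<and> I \<subseteq> B}" using ex_min_gen_subset[OF Gen_R] by blast
next
  fix I1 I2
  assume I1: "I1 \<in> {I. \<exists>B. min_gen B \<and> I \<subseteq> B}" and I2: "I2 \<in> {I. \<exists>B. min_gen B \<and> I \<subseteq> B}"
    and less: "card I1 < card I2"
  from I2 obtain B2 where B2: "min_gen B2" "I2 \<subseteq> B2" by blast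
  from I1 obtain B0 where B0: "min_gen B0 \<and> I1 \<subseteq> B0" by blast
  obtain B1 where B1: "min_gen B1" "I1 \<subseteq> B1"
    and max: "\<And>B. min_gen B \<Longrightarrow> I1 \<subseteq> B \<Longrightarrow> card (B2 - B1) \<le> card (B2 - B)"
    using ex_has_least_nat[of "\<lambda>B. min_gen B \<and> I1 \<subseteq> B" B0 "\<lambda>B. card (B2 - B)", OF B0]
    by auto
  have fin: "finite B1" "finite B2" using B1(1) B2(1) min_gen_finite by auto
  show "\<exists>x\<in>I2 - I1. I1 \<union> {x} \<in> {I. \<exists>B. min_gen B \<and> I \<subseteq> B}"
  proof (rule ccontr)
    assume none: "\<not> ?thesis"
    have disj: "I2 \<inter> B1 \<subseteq> I1" using none B1 by blast
    \<comment> \<open>An element outside \<open>B2\<close> could be exchanged without touching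
      \<open>I1\<close>, bringing \<open>B1\<close> closer to \<open>B2\<close>.\<close>
    have sub: "B1 - I1 \<subseteq> B2"
    proof
      fix b assume b: "b \<in> B1 - I1"
      show "b \<in> B2"
      proof (rule ccontr)
        assume "b \<notin> B2"
        then have "b \<in> B1 - B2" using b by blast
        then obtain n where n: "n \<in> B2 - B1" "min_gen (insert n (B1 - {b}))"
          using min_gen_basis_exchange[OF B1(1) B2(1)] by blast
        have "card (B2 - B1) \<le> card (B2 - insert n (B1 - {b}))"
          using b B1(2) by (intro max n(2)) auto
        moreover have "B2 - insert n (B1 - {b}) \<subset> B2 - B1" using n(1) \<open>b \<notin> B2\<close> by blast
        ultimately show False using fin by (meson finite_Diff linorder_not_less psubset_card_mono)
      qed
    qed
    have "card (B1 - I1) \<le> card (B2 - I2)"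
      using sub disj fin by (intro card_mono) auto
    moreover have "card B1 = card B2"
      using card_le_min_gen B1(1) B2(1) by (simp add: le_antisym)
    moreover have "card (B1 - I1) = card B1 - card I1" "card I1 \<le> card B1"
      using B1(2) fin by (auto intro: card_Diff_subset card_mono finite_subset)
    moreover have "card (B2 - I2) = card B2 - card I2" "card I2 \<le> card B2"
      using B2(2) fin by (auto intro: card_Diff_subset card_mono finite_subset)
    ultimately show False using less by linarith
  qed
qed (use min_gen_subset in blast)+

lemma bases_min_gen: "bases {I. \<exists>B. min_gen B \<and> I \<subseteq> B} = {B. min_gen B}"
proof -
  have eq: "B = B'" if "min_gen B" "min_gen B'" "B \<subseteq> B'" for B B'
    using that unfolding min_gen_def by blast
  show ?thesis
  proof (intro set_eqI iffI)
    fix B assume "B \<in> bases {I. \<exists>B. min_gen B \<and> I \<subseteq> B}"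
    then obtain B' where "min_gen B'" "B \<subseteq> B'" "\<not> B \<subset> B'"
      unfolding bases_def by auto
    then show "B \<in> {B. min_gen B}" by auto
  next
    fix B assume "B \<in> {B. min_gen B}"
    then have "min_gen B" by simp
    moreover have "I = B" if "B \<subseteq> I" "min_gen B'" "I \<subseteq> B'" for I B'
      using eq[OF \<open>min_gen B\<close> \<open>min_gen B'\<close>] that by auto
    ultimately show "B \<in> bases {I. \<exists>B. min_gen B \<and> I \<subseteq> B}"
      unfolding bases_def by blast
  qed
qed

end

section \<open>Aho graphs\<close>

definition aho_graph :: "'v triple set \<Rightarrow> 'v set \<Rightarrow> 'v rel" where
  "aho_graph S L = {(p, q). \<exists>r. ({p, q}, r) \<in> S \<and> p \<in> L \<and> q \<in> L \<and> r \<in> L}"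

definition joined :: "'v triple set \<Rightarrow> 'v set \<Rightarrow> 'v \<Rightarrow> 'v \<Rightarrow> bool" where
  "joined S L p q \<longleftrightarrow> (p, q) \<in> (aho_graph S L)\<^sup>*"

text \<open>The consistency criterion behind the BUILD algorithm. \<open>L\<close> ranges over
  arbitrary sets, so points that are no leaves of a given tree also occur; they are isolated in the
  Aho graph of triples displayed by that tree.\<close>

definition aho_disconnected :: "'v triple set \<Rightarrow> bool" where
  "aho_disconnected S \<longleftrightarrow>
     (\<forall>L x y. x \<in> L \<longrightarrow> y \<in> L \<longrightarrow> x \<noteq> y \<longrightarrow> (\<exists>u\<in>L. \<exists>v\<in>L. \<not> joined S L u v))"

text \<open>
  For \<open>aho_disconnected\<close> sets this is the inference rule of Bryant and Steel: the Aho graph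
  on \<open>L\<close> has exactly two components, one with \<open>x\<close> and \<open>y\<close>, the other with \<open>z\<close>.
\<close>
definition inferred :: "'v triple set \<Rightarrow> 'v triple set" where
  "inferred S = {({x, y}, z) |x y z. distinct [x, y, z] \<and>
     (\<exists>L. x \<in> L \<and> y \<in> L \<and> z \<in> L \<and> joined S L x y \<and> (\<forall>v\<in>L. joined S L v x \<or> joined S L v z))}"

definition proper_triples :: "'v triple set \<Rightarrow> bool" where
  "proper_triples S \<longleftrightarrow> (\<forall>t\<in>S. \<exists>x y z. t = ({x, y}, z) \<and> distinct [x, y, z])"

section \<open>Connectivity in Aho graphs and the inference rule\<close>

lemma aho_graph_sym: "sym (aho_graph S L)"
  unfolding aho_graph_def sym_def by (auto simp: insert_commute)

lemma aho_graph_mono: "S \<subseteq> S' \<Longrightarrow> L \<subseteq> L' \<Longrightarrow> aho_graph S L \<subseteq> aho_graph S' L'"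
  unfolding aho_graph_def by blast

lemma joined_refl [simp]: "joined S L x x"
  by (simp add: joined_def)

lemma joined_sym: "joined S L x y \<Longrightarrow> joined S L y x"
  unfolding joined_def using sym_rtrancl[OF aho_graph_sym] by (metis symD)

lemma joined_trans: "joined S L x y \<Longrightarrow> joined S L y z \<Longrightarrow> joined S L x z"
  unfolding joined_def by (rule rtrancl_trans)

lemma joined_mono: "joined S L x y \<Longrightarrow> S \<subseteq> S' \<Longrightarrow> L \<subseteq> L' \<Longrightarrow> joined S' L' x y"
  unfolding joined_def using rtrancl_mono[OF aho_graph_mono] by blast

lemma joined_triple:
  "({p, q}, r) \<in> S \<Longrightarrow> p \<in> L \<Longrightarrow> q \<in> L \<Longrightarrow> r \<in> L \<Longrightarrow> joined S L p q"
  unfolding joined_def aho_graph_def by blast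

lemma joined_isolated:
  assumes "joined S L x v" "\<And>w. (w, v) \<notin> aho_graph S L"
  shows "x = v"
  using assms unfolding joined_def by (metis rtranclE)

lemma joined_insert_inactive:
  assumes "\<not> (x \<in> L \<and> y \<in> L \<and> z \<in> L)"
  shows "joined (insert ({x, y}, z) S) L p q = joined S L p q"
proof -
  have "aho_graph (insert ({x, y}, z) S) L = aho_graph S L"
    using assms unfolding aho_graph_def by (auto simp: doubleton_eq_iff)
  then show ?thesis by (simp add: joined_def)
qed

text \<open>The new triple contributes at most the edge xy, and a path can be shortened until it
  crosses this edge at most once, in one of two directions.\<close>

lemma joined_insert:
  assumes "joined (insert ({x, y}, z) S) L p q"
  shows "joined S L p q \<or> (joined S L p x \<and> joined S L y q) \<or> (joined S L p y \<and> joined S L x q)"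
  using assms unfolding joined_def[of "insert _ _"]
proof (induction rule: rtrancl_induct)
  case base
  then show ?case by simp
next
  case (step q q')
  then have "(q, q') \<in> aho_graph S L \<or> (q = x \<and> q' = y) \<or> (q = y \<and> q' = x)"
    unfolding aho_graph_def by (auto simp: doubleton_eq_iff)
  then show ?case
  proof (elim disjE conjE)
    assume "(q, q') \<in> aho_graph S L"
    then have "joined S L q q'" by (auto simp: joined_def)
    then show ?thesis using step.IH joined_trans by metis
  next
    assume "q = x" "q' = y"
    then show ?thesis using step.IH joined_sym joined_trans joined_refl by metis
  next
    assume "q = y" "q' = x"
    then show ?thesis using step.IH joined_sym joined_trans joined_refl by metis
  qed
qed

lemma aho_disconnectedD:
  assumes "aho_disconnected S" "x \<in> L" "y \<in> L" "x \<noteq> y" "\<And>v. v \<in> L \<Longrightarrow> joined S L v x"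
  shows False
proof -
  obtain u v where "u \<in> L" "v \<in> L" "\<not> joined S L u v"
    using assms(1)[unfolded aho_disconnected_def, rule_format, OF assms(2-4)] by blast
  then show False using joined_trans[OF assms(5) joined_sym[OF assms(5)]] by blast
qed

lemma inferredI:
  assumes "distinct [x, y, z]" "x \<in> L" "y \<in> L" "z \<in> L" "joined S L x y"
    "\<And>v. v \<in> L \<Longrightarrow> joined S L v x \<or> joined S L v z"
  shows "({x, y}, z) \<in> inferred S"
  using assms unfolding inferred_def by blast

text \<open>The encoding fixes only the set \<open>{x, y}\<close>, so the witnesses may name the
  pair in the other order; the conditions carry over because \<open>x\<close> and \<open>y\<close>
  are joined.\<close>

lemma inferredE:
  assumes "({x, y}, z) \<in> inferred S"
  obtains L where "distinct [x, y, z]" "x \<in> L" "y \<in> L" "z \<in> L" "joined S L x y"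
    "\<And>v. v \<in> L \<Longrightarrow> joined S L v x \<or> joined S L v z"
proof -
  obtain x' y' L where *: "{x, y} = {x', y'}" "distinct [x', y', z]" "x' \<in> L" "y' \<in> L" "z \<in> L"
    "joined S L x' y'" "\<forall>v\<in>L. joined S L v x' \<or> joined S L v z"
    using assms unfolding inferred_def by blast
  then have "joined S L x x'" "joined S L x y"
    by (auto simp: doubleton_eq_iff intro: joined_sym)
  moreover have "distinct [x, y, z]" "x \<in> L" "y \<in> L"
    using *(1-4) by (auto simp: doubleton_eq_iff)
  moreover have "joined S L v x \<or> joined S L v z" if "v \<in> L" for v
    using *(7) that joined_trans[OF _ joined_sym[OF \<open>joined S L x x'\<close>]] by blast
  ultimately show thesis using that[of L] *(5) by blast
qed

lemma inferred_mono:
  assumes "S \<subseteq> S'"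
  shows "inferred S \<subseteq> inferred S'"
proof
  fix t assume "t \<in> inferred S"
  then obtain x y z L where t: "t = ({x, y}, z)" and L: "distinct [x, y, z]" "x \<in> L" "y \<in> L" "z \<in> L"
    "joined S L x y" "\<forall>v\<in>L. joined S L v x \<or> joined S L v z"
    unfolding inferred_def by blast
  have "joined S' L u v" if "joined S L u v" for u v using joined_mono[OF that assms] by simp
  then show "t \<in> inferred S'" unfolding t using L by (intro inferredI[where L = L]) auto
qed

text \<open>Supplies the competing triple that refutes a triple which is not inferred. If each
  addition connected some set, \<open>S\<close> alone would leave at most two components on either
  set. As xy|z is not inferred, \<open>y\<close> is joined to \<open>z\<close> on the one and
  \<open>x\<close> to \<open>z\<close> on the other, so the union is connected.\<close>

lemma inferred_total:
  assumes "aho_disconnected S" "distinct [x, y, z]" "({x, y}, z) \<notin> inferred S"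
  shows "aho_disconnected (insert ({x, z}, y) S) \<or> aho_disconnected (insert ({y, z}, x) S)"
proof (rule ccontr)
  have *: "\<exists>L. u \<in> L \<and> v \<in> L \<and> w \<in> L \<and> (\<forall>p\<in>L. joined S L p u \<or> joined S L p w)"
    if no: "\<not> aho_disconnected (insert ({u, w}, v) S)" for u v w
  proof -
    obtain L where L: "\<exists>p q. p \<in> L \<and> q \<in> L \<and> p \<noteq> q"
      "\<And>p q. p \<in> L \<Longrightarrow> q \<in> L \<Longrightarrow> joined (insert ({u, w}, v) S) L p q"
      using no unfolding aho_disconnected_def by blast
    obtain p q where "p \<in> L" "q \<in> L" "\<not> joined S L p q"
      using assms(1) L(1) unfolding aho_disconnected_def by meson
    \<comment> \<open>\<open>S\<close> alone does not connect \<open>L\<close>, so the added triple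
      must contribute an edge, which takes all three of its leaves.\<close>
    then have act: "u \<in> L \<and> w \<in> L \<and> v \<in> L"
      using L(2) joined_insert_inactive by metis
    have "joined S L p u \<or> joined S L p w" if "p \<in> L" for p
      using joined_insert[OF L(2)[OF that, of u]] act by blast
    then show ?thesis using act by blast
  qed
  assume "\<not> ?thesis"
  then obtain L M where L: "x \<in> L" "y \<in> L" "z \<in> L" "\<forall>p\<in>L. joined S L p x \<or> joined S L p z"
    and M: "x \<in> M" "y \<in> M" "z \<in> M" "\<forall>p\<in>M. joined S M p y \<or> joined S M p z"
    using *[of x z y] *[of y z x] by blast
  have "\<not> joined S L x y" using L assms(2,3) inferredI by metis
  then have yz: "joined S L y z" using L joined_sym by metis
  have "\<not> joined S M y x"
  proof
    assume "joined S M y x"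
    then have "({y, x}, z) \<in> inferred S"
      using M assms(2) by (intro inferredI[where L = M]) auto
    then show False using assms(3) by (simp add: insert_commute)
  qed
  then have xz: "joined S M x z" using M joined_sym by metis
  have "joined S (L \<union> M) y z" "joined S (L \<union> M) x z"
    using yz xz by (auto elim: joined_mono)
  moreover have "joined S (L \<union> M) v x \<or> joined S (L \<union> M) v y \<or> joined S (L \<union> M) v z"
    if "v \<in> L \<union> M" for v
    using that L(4) M(4) by (meson Un_iff joined_mono order_refl sup_ge1 sup_ge2)
  ultimately have "joined S (L \<union> M) v z" if "v \<in> L \<union> M" for v
    using that joined_trans by metis
  then show False
    using aho_disconnectedD[OF assms(1), of z "L \<union> M" x] L(1,3) assms(2) by auto
qed

text \<open>
  If no \<open>n\<close> worked, every edge of the Aho graph that yields \<open>xy|z\<close> from \<open>Y\<close> could be replaced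
  by a path in an Aho graph of \<open>G\<close>; gluing these graphs together would infer \<open>xy|z\<close> from \<open>G\<close>.
\<close>
lemma inferred_exchange:
  assumes disc: "aho_disconnected R" and G: "G \<subseteq> R" and YR: "Y \<subseteq> R" and b: "({x, y}, z) \<in> R"
    and bY: "({x, y}, z) \<in> inferred Y" and bG: "({x, y}, z) \<notin> inferred G"
    and Y: "Y \<subseteq> inferred (insert ({x, y}, z) G)"
  shows "\<exists>n\<in>Y. ({x, y}, z) \<in> inferred (insert n G)"
proof (rule ccontr)
  assume none: "\<not> ?thesis"
  let ?b = "({x, y}, z)"
  obtain L where L: "distinct [x, y, z]" "x \<in> L" "y \<in> L" "z \<in> L" "joined Y L x y"
    "\<And>v. v \<in> L \<Longrightarrow> joined Y L v x \<or> joined Y L v z"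
    using inferredE[OF bY] by metis
  \<comment> \<open>Points of a good set hang on to \<open>L\<close> by edges of \<open>G\<close>,
    so adding the set creates no component away from \<open>L\<close>. Taking the union of all good
    sets avoids choosing one set per edge.\<close>
  define good where "good M \<longleftrightarrow> (\<forall>v\<in>M. \<exists>w\<in>L. joined G M v w)" for M
  define N where "N = \<Union>{M. good M}"
  have N_good: "M \<subseteq> N" if "good M" for M using that unfolding N_def by blast
  have edge: "joined G N p q" if pq: "(p, q) \<in> aho_graph Y L" for p q
  proof -
    obtain r where r: "({p, q}, r) \<in> Y" "p \<in> L" "q \<in> L" "r \<in> L"
      using pq unfolding aho_graph_def by blast
    have "({p, q}, r) \<in> inferred (insert ?b G)" using r(1) Y by blast
    then obtain M where M: "distinct [p, q, r]" "p \<in> M" "q \<in> M" "r \<in> M"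
      "joined (insert ?b G) M p q"
      "\<And>v. v \<in> M \<Longrightarrow> joined (insert ?b G) M v p \<or> joined (insert ?b G) M v r"
      by (rule inferredE) blast
    \<comment> \<open>A path to \<open>p\<close> or \<open>r\<close> either does without the edge xy
      or reaches \<open>x\<close> or \<open>y\<close> before it; all four points lie in
      \<open>L\<close>.\<close>
    have "good M" unfolding good_def
    proof
      fix v assume "v \<in> M"
      then have "joined G M v p \<or> joined G M v r \<or> joined G M v x \<or> joined G M v y"
        using M(6) joined_insert[of x y z G M v] by blast
      then show "\<exists>w\<in>L. joined G M v w" using r L(2,3) by blast
    qed
    moreover have "joined G M p q"
    proof (rule ccontr)
      assume not: "\<not> joined G M p q"
      then have act: "x \<in> M" "y \<in> M" "z \<in> M" using M(5) joined_insert_inactive by metis+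
      have px: "(joined G M p x \<and> joined G M y q) \<or> (joined G M p y \<and> joined G M x q)"
        using joined_insert[OF M(5)] not by blast
      have xyb: "joined (insert ?b G) M x y" using act by (auto intro: joined_triple)
      have pxb: "joined (insert ?b G) M p x"
      proof -
        have "joined (insert ?b G) M p x \<or> joined (insert ?b G) M p y"
          using px joined_mono[of G M _ _ "insert ?b G" M] by blast
        then show ?thesis using joined_trans[OF _ joined_sym[OF xyb]] by blast
      qed
      show False
      proof (cases "joined (insert ?b G) M z r")
        \<comment> \<open>With \<open>z\<close> on the side of \<open>r\<close>, pq|r can take the
          place of xy|z: the connection from \<open>p\<close> to \<open>q\<close> used the edge xy,
          so the edge pq in turn reconnects \<open>x\<close> and \<open>y\<close>. Every point of
          \<open>M\<close> is then joined to \<open>x\<close> or \<open>z\<close>.\<close>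
        case True
        have nM: "joined (insert ({p, q}, r) G) M p q" using M(2-4) by (auto intro: joined_triple)
        have up: "joined (insert ({p, q}, r) G) M u v" if "joined G M u v" for u v
          using joined_mono[OF that subset_insertI order_refl] .
        have xyn: "joined (insert ({p, q}, r) G) M x y"
          using px
        proof (elim disjE conjE)
          assume "joined G M p x" "joined G M y q"
          then show ?thesis by (metis up nM joined_sym joined_trans)
        next
          assume "joined G M p y" "joined G M x q"
          then show ?thesis by (metis up nM joined_sym joined_trans)
        qed
        have bn: "joined (insert ({p, q}, r) G) M u v" if "joined (insert ?b G) M u v" for u v
          using joined_insert[OF that]
        proof (elim disjE conjE)
          assume "joined G M u x" "joined G M y v"
          then show ?thesis by (metis up xyn joined_trans)
        next
          assume "joined G M u y" "joined G M x v"
          then show ?thesis by (metis up xyn joined_sym joined_trans)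
        qed (rule up)
        have "joined (insert ({p, q}, r) G) M v x \<or> joined (insert ({p, q}, r) G) M v z"
          if "v \<in> M" for v
          using M(6)[OF that] joined_trans[OF bn bn[OF pxb]]
            joined_trans[OF bn joined_sym[OF bn[OF True]]] by blast
        then have "?b \<in> inferred (insert ({p, q}, r) G)"
          using L(1) act xyn by (intro inferredI[where L = M]) auto
        then show False using none r(1) by blast
      next
        \<comment> \<open>Now \<open>z\<close> is on the side of \<open>p\<close>, as is
          \<open>x\<close>. Points of \<open>L\<close> are joined to \<open>x\<close> or
          \<open>z\<close>, hence to \<open>p\<close> in \<open>L \<union> M\<close>; since
          \<open>r\<close> is one of them, the rest of \<open>M\<close> follows, and
          \<open>R\<close> connects \<open>L \<union> M\<close>.\<close>
        case False
        then have zp: "joined (insert ?b G) M z p" using M(6) act by blast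
        have upM: "joined R (L \<union> M) u v" if "joined (insert ?b G) M u v" for u v
          using G b by (intro joined_mono[OF that]) auto
        have upL: "joined R (L \<union> M) u v" if "joined Y L u v" for u v
          using YR by (intro joined_mono[OF that]) auto
        have "joined R (L \<union> M) v p" if v: "v \<in> L \<union> M" for v
        proof -
          have Lp: "joined R (L \<union> M) u p" if "u \<in> L" for u
            using L(6)[OF that] joined_trans[OF upL joined_sym[OF upM[OF pxb]]]
              joined_trans[OF upL upM[OF zp]] by blast
          show ?thesis
          proof (cases "v \<in> L")
            case False
            then have "v \<in> M" using v by blast
            then show ?thesis using M(6) upM joined_trans[OF upM Lp[OF r(4)]] by blast
          qed (rule Lp)
        qed
        then show False
          using aho_disconnectedD[OF disc, of p "L \<union> M" q] M(1-3) by auto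
      qed
    qed
    ultimately show ?thesis using joined_mono[OF _ order_refl N_good] by blast
  qed
  have L_N: "joined G N u v" if "joined Y L u v" for u v
    using that unfolding joined_def[of Y]
  proof (induction rule: rtrancl_induct)
    case (step v v')
    show ?case by (rule joined_trans[OF step.IH edge[OF step.hyps(2)]])
  qed simp
  have "good L" unfolding good_def
  proof
    fix v assume "v \<in> L"
    then show "\<exists>w\<in>L. joined G L v w" using joined_refl[of G L v] by blast
  qed
  then have "L \<subseteq> N" by (rule N_good)
  have "joined G N v x \<or> joined G N v z" if v: "v \<in> N" for v
  proof -
    obtain M where M: "good M" "v \<in> M" using v unfolding N_def by blast
    then obtain w where w: "w \<in> L" "joined G M v w" unfolding good_def by blast
    have "joined G N v w" using joined_mono[OF w(2) order_refl N_good[OF M(1)]] .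
    then show ?thesis using L(6)[OF w(1)] joined_trans[of G N v w] L_N by blast
  qed
  then have "?b \<in> inferred G"
    using L \<open>L \<subseteq> N\<close> L_N by (intro inferredI[where L = N]) auto
  then show False using bG by blast
qed

section \<open>Trees as relations\<close>

definition linked :: "'v rel \<Rightarrow> 'v set \<Rightarrow> 'v \<Rightarrow> 'v \<Rightarrow> bool" where
  "linked E S x y \<longleftrightarrow> x \<in> S \<and> y \<in> S \<and> (x, y) \<in> (E \<inter> S \<times> S)\<^sup>*"

lemma linked_in: "linked E S x y \<Longrightarrow> x \<in> S" "linked E S x y \<Longrightarrow> y \<in> S"
  by (simp_all add: linked_def)

lemma linked_refl: "x \<in> S \<Longrightarrow> linked E S x x"
  by (simp add: linked_def)

lemma linked_trans: "linked E S x y \<Longrightarrow> linked E S y z \<Longrightarrow> linked E S x z"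
  unfolding linked_def by (auto intro: rtrancl_trans)

lemma linked_mono:
  assumes "linked E S x y" "E \<subseteq> E'" "S \<subseteq> S'"
  shows "linked E' S' x y"
proof -
  have "(E \<inter> S \<times> S)\<^sup>* \<subseteq> (E' \<inter> S' \<times> S')\<^sup>*" using assms by (intro rtrancl_mono) auto
  then show ?thesis using assms unfolding linked_def by auto
qed

lemma linked_edge: "(x, y) \<in> E \<Longrightarrow> x \<in> S \<Longrightarrow> y \<in> S \<Longrightarrow> linked E S x y"
  unfolding linked_def by auto

lemma linked_induct [consumes 1, case_names base step]:
  assumes "linked E S x y" "x \<in> S \<Longrightarrow> P x"
    and "\<And>y z. linked E S x y \<Longrightarrow> (y, z) \<in> E \<Longrightarrow> y \<in> S \<Longrightarrow> z \<in> S \<Longrightarrow> P y \<Longrightarrow> P z"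
  shows "P y"
proof -
  have x: "x \<in> S" and "(x, y) \<in> (E \<inter> S \<times> S)\<^sup>*" using assms(1) by (auto simp: linked_def)
  from this(2) show ?thesis
  proof (induction rule: rtrancl_induct)
    case base
    show ?case using assms(2) x by simp
  next
    case (step y z)
    then have "linked E S x y" using x by (auto simp: linked_def)
    then show ?case using assms(3)[of y z] step by blast
  qed
qed

lemma linked_sym:
  assumes "sym E" "linked E S x y"
  shows "linked E S y x"
  using assms(2)
proof (induction rule: linked_induct)
  case base
  then show ?case by (rule linked_refl)
next
  case (step y z)
  have "linked E S z y" using step assms(1) by (intro linked_edge) (auto dest: symD)
  then show ?case using step.IH by (rule linked_trans)
qed

text \<open>Used to change the ambient set: a path from \<open>x\<close> survives in every set that
  contains the component of \<open>x\<close>.\<close>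

lemma linked_component:
  assumes "linked E S x y"
  shows "linked E {v. linked E S x v} x y"
  using assms
proof (induction rule: linked_induct)
  case base
  then show ?case by (auto intro: linked_refl)
next
  case (step y z)
  have "linked E S x z" using step linked_trans[OF step.hyps(1) linked_edge] by blast
  then have "linked E {v. linked E S x v} y z" using step by (intro linked_edge) auto
  with step.IH show ?case by (rule linked_trans)
qed

lemma linked_avoid:
  assumes "linked E S x y" "\<not> linked E S x w"
  shows "linked E (S - {w}) x y"
  using linked_component[OF assms(1)] by (rule linked_mono) (use assms(2) in \<open>auto dest: linked_in\<close>)

text \<open>If deleting \<open>u\<close> destroys the connection, the path runs into
  \<open>u\<close>; \<open>w\<close> is the vertex before the first visit. The target may be
  \<open>u\<close> itself.\<close>

lemma linked_hit:
  assumes "linked E S x y" "\<not> linked E (S - {u}) x y" "x \<noteq> u"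
  shows "\<exists>w. (w, u) \<in> E \<and> linked E (S - {u}) x w"
proof -
  have "linked E (S - {u}) x y \<or> (\<exists>w. (w, u) \<in> E \<and> linked E (S - {u}) x w)"
    using assms(1)
  proof (induction rule: linked_induct)
    case base
    then show ?case using assms(3) linked_refl[of x "S - {u}"] by blast
  next
    case (step y z)
    show ?case
    proof (cases "linked E (S - {u}) x y")
      case True
      show ?thesis
      proof (cases "z = u")
        case False
        then have "linked E (S - {u}) y z" using step linked_in[OF True] by (intro linked_edge) auto
        then show ?thesis using linked_trans[OF True] by blast
      qed (use True step in blast)
    qed (use step.IH in blast)
  qed
  then show ?thesis using assms(2) by blast
qed

text \<open>\<open>S\<close> holds the path from \<open>a\<close> to \<open>b\<close>, its
  complement the path from \<open>c\<close> to the root. One separating set stands for the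
  disjointness of two paths.\<close>

definition displayed_rel :: "'v set \<Rightarrow> 'v rel \<Rightarrow> 'v \<Rightarrow> 'v \<Rightarrow> 'v \<Rightarrow> 'v \<Rightarrow> bool" where
  "displayed_rel V E r a b c \<longleftrightarrow> (\<exists>S\<subseteq>V. linked E S a b \<and> linked E (V - S) c r)"

text \<open>
  That a vertex separates its distinct neighbours replaces the absence of cycles of length at
  least 3.
\<close>
locale rel_tree =
  fixes V :: "'v set" and E :: "'v rel" and \<rho> :: 'v
  assumes finite_V: "finite V"
    and E_sub: "E \<subseteq> V \<times> V"
    and sym_E: "sym E"
    and root_in: "\<rho> \<in> V"
    and linked_root: "v \<in> V \<Longrightarrow> linked E V v \<rho>"
    and acyclic: "(v, u) \<in> E \<Longrightarrow> (v, w) \<in> E \<Longrightarrow> linked E (V - {v}) u w \<Longrightarrow> u = w"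
begin

lemma sym_linked: "linked E S x y \<Longrightarrow> linked E S y x"
  using linked_sym[OF sym_E] .

lemma sym_edge: "(x, y) \<in> E \<Longrightarrow> (y, x) \<in> E"
  using sym_E by (rule symD)

section \<open>Descendants, last common ancestors and branches\<close>

definition below :: "'v \<Rightarrow> 'v set" where
  "below u = {v \<in> V. \<not> linked E (V - {u}) v \<rho>}"

abbreviation displ :: "'v \<Rightarrow> 'v \<Rightarrow> 'v \<Rightarrow> bool" where
  "displ \<equiv> displayed_rel V E \<rho>"

lemma below_root: "below \<rho> = V"
  unfolding below_def by (auto dest: linked_in)

lemma step_towards_below:
  assumes "v \<in> below u" "v \<noteq> u"
  shows "\<exists>w. (w, u) \<in> E \<and> linked E (V - {u}) v w"
  using assms linked_root unfolding below_def by (intro linked_hit[where y = \<rho>]) auto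

lemma step_towards_root:
  assumes "u \<in> V" "u \<noteq> \<rho>"
  shows "\<exists>w. (u, w) \<in> E \<and> linked E (V - {u}) w \<rho>"
proof -
  have "\<exists>w. (w, u) \<in> E \<and> linked E (V - {u}) \<rho> w"
    using sym_linked[OF linked_root[OF assms(1)]] assms(2)
    by (intro linked_hit[where y = u]) (auto dest: linked_in)
  then show ?thesis using sym_edge sym_linked by blast
qed

text \<open>The path from \<open>c\<close> to the root has to pass \<open>u\<close>, and the path
  from \<open>a\<close> to \<open>b\<close> is disjoint from it.\<close>

lemma displ_imp_linked:
  assumes "displ a b c" "c \<in> below u"
  shows "linked E (V - {u}) a b"
proof -
  obtain S where S: "S \<subseteq> V" "linked E S a b" "linked E (V - S) c \<rho>"
    using assms(1) unfolding displayed_rel_def by blast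
  have "u \<notin> S"
  proof
    assume "u \<in> S"
    then have "V - S \<subseteq> V - {u}" by blast
    then have "linked E (V - {u}) c \<rho>" using linked_mono[OF S(3) order_refl] by simp
    then show False using assms(2) by (simp add: below_def)
  qed
  then have "S \<subseteq> V - {u}" using S(1) by blast
  then show ?thesis using linked_mono[OF S(2) order_refl] by simp
qed

text \<open>The branch of \<open>a\<close> at \<open>u\<close> serves as \<open>S\<close>. It
  contains neither \<open>u\<close> nor the root, so \<open>c\<close> can climb through its own
  branch to \<open>u\<close> and on to the root outside \<open>S\<close>.\<close>

lemma linked_imp_displ:
  assumes ab: "linked E (V - {u}) a b" and ac: "\<not> linked E (V - {u}) a c"
    and a: "a \<in> below u" and c: "c \<in> below u" "c \<noteq> u" and u: "u \<in> V"
  shows "displ a b c"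
proof -
  let ?S = "{v. linked E (V - {u}) a v}"
  have off: "linked E (V - ?S) x y" if "linked E (V - {u}) x y" "\<not> linked E (V - {u}) a x" for x y
    using linked_component[OF that(1)]
  proof (rule linked_mono)
    show "{v. linked E (V - {u}) x v} \<subseteq> V - ?S"
    proof
      fix v assume v: "v \<in> {v. linked E (V - {u}) x v}"
      have "\<not> linked E (V - {u}) a v"
        using that(2) linked_trans[of E "V - {u}" a v x] sym_linked v by blast
      then show "v \<in> V - ?S" using v by (auto dest: linked_in)
    qed
  qed simp
  have uS: "u \<in> V - ?S" using u by (auto dest: linked_in)
  obtain w where w: "(w, u) \<in> E" "linked E (V - {u}) c w"
    using step_towards_below[OF c] by blast
  have cw: "linked E (V - ?S) c w" using off[OF w(2) ac] .
  then have cu: "linked E (V - ?S) c u"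
    using linked_trans[OF cw linked_edge[OF w(1) linked_in(2)[OF cw] uS]] by simp
  have "linked E (V - ?S) u \<rho>"
  proof (cases "u = \<rho>")
    case True
    then show ?thesis using uS linked_refl by metis
  next
    case False
    then obtain w' where w': "(u, w') \<in> E" "linked E (V - {u}) w' \<rho>"
      using step_towards_root u by blast
    have "\<not> linked E (V - {u}) a w'"
      using linked_trans[OF _ w'(2)] a by (auto simp: below_def)
    then have r: "linked E (V - ?S) w' \<rho>" using off w'(2) by blast
    show ?thesis by (rule linked_trans[OF linked_edge[OF w'(1) uS linked_in(1)[OF r]] r])
  qed
  then have "linked E (V - ?S) c \<rho>" using linked_trans[OF cu] by blast
  moreover have "linked E ?S a b" using linked_component[OF ab] .
  moreover have "?S \<subseteq> V" by (auto dest: linked_in)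
  ultimately show ?thesis unfolding displayed_rel_def by blast
qed

text \<open>The vertex \<open>u\<close> is the last common ancestor of \<open>L\<close>.\<close>
lemma ex_separating_vertex:
  assumes L: "L \<subseteq> V" "\<rho> \<notin> L" and two: "x \<in> L" "y \<in> L" "x \<noteq> y"
    and leaf: "\<And>l u w. l \<in> L \<Longrightarrow> (l, u) \<in> E \<Longrightarrow> (l, w) \<in> E \<Longrightarrow> u = w"
  shows "\<exists>u\<in>V - L. L \<subseteq> below u \<and> (\<exists>a\<in>L. \<exists>b\<in>L. \<not> linked E (V - {u}) a b)"
proof -
  have "\<rho> \<in> V \<and> L \<subseteq> below \<rho>" using L root_in below_root by simp
  \<comment> \<open>A common ancestor with the fewest descendants.\<close>
  from ex_has_least_nat[of "\<lambda>u. u \<in> V \<and> L \<subseteq> below u" \<rho> "\<lambda>u. card (below u)", OF this]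
  obtain u where u: "u \<in> V" "L \<subseteq> below u"
    and least: "\<And>w. w \<in> V \<Longrightarrow> L \<subseteq> below w \<Longrightarrow> card (below u) \<le> card (below w)"
    by auto
  \<comment> \<open>The only neighbour of a leaf would lead both to another element of
    \<open>L\<close> and to the root.\<close>
  have uL: "u \<notin> L"
  proof
    assume "u \<in> L"
    then obtain l where l: "l \<in> L" "l \<noteq> u" using two by metis
    obtain w where w: "(w, u) \<in> E" "linked E (V - {u}) l w"
      using step_towards_below[of l u] l u(2) by blast
    obtain w' where w': "(u, w') \<in> E" "linked E (V - {u}) w' \<rho>"
      using step_towards_root[of u] u(1) \<open>u \<in> L\<close> L(2) by blast
    have "w = w'" using leaf[OF \<open>u \<in> L\<close> sym_edge[OF w(1)] w'(1)] .
    then have "linked E (V - {u}) l \<rho>" using linked_trans[OF w(2)] w'(2) by simp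
    then show False using l(1) u(2) by (auto simp: below_def)
  qed
  moreover have "\<exists>a\<in>L. \<exists>b\<in>L. \<not> linked E (V - {u}) a b"
  proof (rule ccontr)
    assume "\<not> ?thesis"
    then have same: "linked E (V - {u}) a x" if a: "a \<in> L" for a using a two(1) by blast
    \<comment> \<open>If \<open>L\<close> lies in one branch at \<open>u\<close>, the neighbour
      \<open>w\<close> of \<open>u\<close> in that branch is a common ancestor with fewer
      descendants.\<close>
    obtain w where w: "(w, u) \<in> E" "linked E (V - {u}) x w"
      using step_towards_below[of x u] two(1) u(2) uL by blast
    have wV: "w \<in> V" "w \<noteq> u" using linked_in(2)[OF w(2)] by auto
    have w_root: "\<not> linked E (V - {u}) w \<rho>"
      using linked_trans[OF w(2)] two(1) u(2) by (auto simp: below_def)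
    have "L \<subseteq> below w"
    proof
      fix l assume l: "l \<in> L"
      have "\<not> linked E (V - {w}) l \<rho>"
      proof
        \<comment> \<open>Such a path must enter \<open>u\<close> from a neighbour in the same
          branch as \<open>w\<close>, and by \<open>acyclic\<close> that neighbour is
          \<open>w\<close>.\<close>
        assume lr: "linked E (V - {w}) l \<rho>"
        have "\<not> linked E (V - {w} - {u}) l \<rho>"
        proof
          assume "linked E (V - {w} - {u}) l \<rho>"
          then have "linked E (V - {u}) l \<rho>" by (rule linked_mono) auto
          then show False using l u(2) by (auto simp: below_def)
        qed
        then obtain w' where w': "(w', u) \<in> E" "linked E (V - {w} - {u}) l w'"
          using linked_hit[OF lr] l uL by blast
        have "linked E (V - {u}) l w'" using w'(2) by (rule linked_mono) auto
        then have "linked E (V - {u}) w w'"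
          using linked_trans[OF sym_linked[OF w(2)] linked_trans[OF sym_linked[OF same[OF l]]]]
          by blast
        then have "w = w'" using acyclic[of u w w'] sym_edge w(1) w'(1) by blast
        then show False using linked_in(2)[OF w'(2)] by simp
      qed
      then show "l \<in> below w" using l L(1) by (auto simp: below_def)
    qed
    have "linked E (V - {w}) u \<rho>"
    proof (cases "u = \<rho>")
      case True
      then show ?thesis using linked_refl[of u "V - {w}" E] u(1) wV by auto
    next
      case False
      then obtain w' where w': "(u, w') \<in> E" "linked E (V - {u}) w' \<rho>"
        using step_towards_root u(1) by blast
      have "\<not> linked E (V - {u}) w' w"
        using w_root linked_trans[OF sym_linked w'(2)] by blast
      then have "linked E (V - {u} - {w}) w' \<rho>" using linked_avoid w'(2) by metis
      then have wr: "linked E (V - {w}) w' \<rho>" by (rule linked_mono) auto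
      have "linked E (V - {w}) u w'"
        using w'(1) u(1) wV linked_in(1)[OF wr] by (intro linked_edge) auto
      then show ?thesis using wr by (rule linked_trans)
    qed
    then have "u \<notin> below w" by (simp add: below_def)
    have "below w \<subseteq> below u"
    proof
      fix v assume v: "v \<in> below w"
      have "\<not> linked E (V - {u}) v \<rho>"
      proof
        assume vr: "linked E (V - {u}) v \<rho>"
        have "\<not> linked E (V - {u}) v w"
          using w_root linked_trans[OF sym_linked vr] by blast
        then have "linked E (V - {u} - {w}) v \<rho>" using linked_avoid vr by metis
        then have "linked E (V - {w}) v \<rho>" by (rule linked_mono) auto
        then show False using v by (simp add: below_def)
      qed
      then show "v \<in> below u" using v by (simp add: below_def)
    qed
    moreover have "u \<in> below u" using u(1) by (auto simp: below_def dest: linked_in)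
    ultimately have "below w \<subset> below u" using \<open>u \<notin> below w\<close> by blast
    moreover have "finite (below u)" using finite_V by (simp add: below_def)
    ultimately have "card (below w) < card (below u)" by (simp add: psubset_card_mono)
    then show False using least[OF wV(1) \<open>L \<subseteq> below w\<close>] by simp
  qed
  ultimately show ?thesis using u by blast
qed

text \<open>The label of a leaf is its branch at the last common ancestor. These labels are all that
  the Aho graph arguments use of the shape of the tree.\<close>

lemma ex_branches:
  assumes "L \<subseteq> V" "\<rho> \<notin> L" "x \<in> L" "y \<in> L" "x \<noteq> y"
    and "\<And>l u w. l \<in> L \<Longrightarrow> (l, u) \<in> E \<Longrightarrow> (l, w) \<in> E \<Longrightarrow> u = w"
  obtains f :: "'v \<Rightarrow> 'v set" where "\<exists>a\<in>L. \<exists>b\<in>L. f a \<noteq> f b"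
    "\<And>a b c. a \<in> L \<Longrightarrow> b \<in> L \<Longrightarrow> c \<in> L \<Longrightarrow> displ a b c \<Longrightarrow> f a = f b"
    "\<And>a b c. a \<in> L \<Longrightarrow> b \<in> L \<Longrightarrow> c \<in> L \<Longrightarrow> f a = f b \<Longrightarrow> f a \<noteq> f c \<Longrightarrow> displ a b c"
proof -
  have "\<exists>u\<in>V - L. L \<subseteq> below u \<and> (\<exists>a\<in>L. \<exists>b\<in>L. \<not> linked E (V - {u}) a b)"
    using ex_separating_vertex[OF assms(1-5)] assms(6) by simp
  then obtain u where u: "u \<in> V" "u \<notin> L" "L \<subseteq> below u"
    "\<exists>a\<in>L. \<exists>b\<in>L. \<not> linked E (V - {u}) a b"
    by blast
  define f where "f a = {v. linked E (V - {u}) a v}" for a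
  have f_iff: "f a = f b \<longleftrightarrow> linked E (V - {u}) a b" if "a \<in> L" "b \<in> L" for a b
  proof
    assume "f a = f b"
    moreover have "b \<in> f b" using that u(2) assms(1) unfolding f_def by (auto intro: linked_refl)
    ultimately have "b \<in> f a" by simp
    then show "linked E (V - {u}) a b" by (simp add: f_def)
  next
    assume ab: "linked E (V - {u}) a b"
    show "f a = f b"
      unfolding f_def using linked_trans[OF ab] linked_trans[OF sym_linked[OF ab]] by blast
  qed
  show thesis
  proof (rule that[of f])
    show "\<exists>a\<in>L. \<exists>b\<in>L. f a \<noteq> f b" using u(4) f_iff by blast
  next
    fix a b c assume "a \<in> L" "b \<in> L" "c \<in> L" "displ a b c"
    then show "f a = f b" using f_iff displ_imp_linked u(3) by blast
  next
    fix a b c assume "a \<in> L" "b \<in> L" "c \<in> L" "f a = f b" "f a \<noteq> f c"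
    then show "displ a b c" using f_iff linked_imp_displ[of u a b c] u by blast
  qed
qed

end

section \<open>Rooted trees of the graph library\<close>

context pair_wf_digraph
begin

lemma awalk_imp_linked:
  assumes "awalk x p y" "set (awalk_verts x p) \<subseteq> S"
  shows "linked (parcs G) S x y"
  using assms
proof (induction p arbitrary: x)
  case Nil
  then show ?case by (auto simp: awalk_Nil_iff intro: linked_refl)
next
  case (Cons e p)
  obtain v where e: "e = (x, v)" using Cons.prems(1) by (cases e) (auto simp: awalk_Cons_iff)
  have v: "awalk v p y" "(x, v) \<in> parcs G" using Cons.prems(1) e by (auto simp: awalk_Cons_iff)
  have vS: "set (awalk_verts v p) \<subseteq> S" "x \<in> S" using Cons.prems(2) e by auto
  have "linked (parcs G) S v y" using Cons.IH[OF v(1) vS(1)] .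
  moreover have "linked (parcs G) S x v"
    using v(2) vS(2) linked_in(1)[OF calculation] by (rule linked_edge)
  ultimately show ?case using linked_trans by metis
qed

lemma linked_imp_apath:
  assumes "linked (parcs G) S x y" "S \<subseteq> pverts G"
  shows "\<exists>p. apath x p y \<and> set (awalk_verts x p) \<subseteq> S"
proof -
  have "\<exists>p. awalk x p y \<and> set (awalk_verts x p) \<subseteq> S"
    using assms(1)
  proof (induction rule: linked_induct)
    case base
    then show ?case using assms(2) by (intro exI[of _ "[]"]) (auto simp: awalk_Nil_iff)
  next
    case (step y z)
    then obtain p where p: "awalk x p y" "set (awalk_verts x p) \<subseteq> S" by blast
    have yz: "awalk y [(y, z)] z"
      using step(2) by (auto simp: awalk_simps dest: wellformed')
    have w: "awalk x (p @ [(y, z)]) z" using awalk_appendI[OF p(1) yz] .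
    have "set (awalk_verts x (p @ [(y, z)])) = set (awalk_verts x p) \<union> set (awalk_verts y [(y, z)])"
      using set_awalk_verts_append[OF p(1) yz] .
    then have "set (awalk_verts x (p @ [(y, z)])) \<subseteq> S" using p(2) step by auto
    then show ?case using w by blast
  qed
  then obtain p where p: "awalk x p y" "set (awalk_verts x p) \<subseteq> S" by blast
  have ap: "apath x (awalk_to_apath p) y" using apath_awalk_to_apath[OF p(1)] .
  then have aw: "awalk x (awalk_to_apath p) y" by (simp add: apath_def)
  have "set (awalk_verts x (awalk_to_apath p)) \<subseteq> set (awalk_verts x p)"
    using awalk_to_apath_subset[OF p(1)] set_awalk_verts[OF p(1)] set_awalk_verts[OF aw] by auto
  then show ?thesis using ap p(2) by blast
qed

end

section \<open>From trees of the graph library to relations and back\<close>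

lemma (in pair_wf_digraph) awalk_verts_subset: "awalk u p v \<Longrightarrow> set (awalk_verts u p) \<subseteq> pverts G"
  using awalk_verts_in_verts by (auto simp: awalk_def)

lemma vertex_degree_eq: "vertex_degree G v = card (parcs G `` {v})"
proof -
  have "out_arcs (with_proj G) v = Pair v ` (parcs G `` {v})"
    unfolding out_arcs_def by auto
  then show ?thesis
    unfolding vertex_degree_def out_degree_def by (simp add: card_image inj_on_def)
qed

lemma tree_leaf_neighbour:
  assumes "v \<in> tree_leaves G" "(v, u) \<in> parcs G" "(v, w) \<in> parcs G"
  shows "u = w"
proof -
  have "card (parcs G `` {v}) = 1" using assms(1) by (simp add: tree_leaves_def vertex_degree_eq)
  then obtain x where "parcs G `` {v} = {x}" by (auto simp: card_1_singleton_iff)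
  moreover have "u \<in> parcs G `` {v}" "w \<in> parcs G `` {v}" using assms(2,3) by auto
  ultimately show ?thesis by simp
qed

lemma root_not_leaf: "rooted_tree (G, \<rho>) \<Longrightarrow> \<rho> \<notin> tree_leaves G"
  by (simp add: rooted_tree_def inner_vertices_def)

text \<open>For \<open>acyclic\<close>: if \<open>u \<noteq> w\<close>, a path between them off
  \<open>v\<close> has at least one arc, and the two arcs at \<open>v\<close> close it to a cycle of
  length at least 3.\<close>

lemma rel_tree_rooted_tree:
  assumes "rooted_tree (G, \<rho>)"
  shows "rel_tree (pverts G) (parcs G) \<rho>"
proof -
  have "pair_graph G" and conn: "connected (with_proj G)"
    and acyc: "\<And>p. pre_digraph.cycle (with_proj G) p \<Longrightarrow> length p < 3"
    using assms by (auto simp: rooted_tree_def undirected_tree_def not_le)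
  then interpret pair_graph G by simp
  have root: "\<rho> \<in> pverts G" using assms by (simp add: rooted_tree_def inner_vertices_def)
  show ?thesis
  proof
    show "finite (pverts G)" by (rule pair_finite_verts)
    show "parcs G \<subseteq> pverts G \<times> pverts G" by (auto dest: wellformed')
    show sym: "sym (parcs G)" using arcs_symmetric by (auto intro: symI)
    show "\<rho> \<in> pverts G" by (rule root)
  next
    fix v assume "v \<in> pverts G"
    then have "v \<rightarrow>\<^sup>*\<^bsub>mk_symmetric (with_proj G)\<^esub> \<rho>"
      using conn root by (simp add: connected_def strongly_connected_def)
    then have "v \<rightarrow>\<^sup>*\<^bsub>with_proj G\<^esub> \<rho>" using reachable_mk_symmetric_eq[OF pair_sym_arcs] by simp
    then obtain p where "awalk v p \<rho>" using reachable_awalk by blast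
    then show "linked (parcs G) (pverts G) v \<rho>"
      using awalk_imp_linked awalk_verts_subset by blast
  next
    fix v u w assume vu: "(v, u) \<in> parcs G" and vw: "(v, w) \<in> parcs G"
      and l: "linked (parcs G) (pverts G - {v}) u w"
    show "u = w"
    proof (rule ccontr)
      assume "u \<noteq> w"
      obtain p where p: "apath u p w" "set (awalk_verts u p) \<subseteq> pverts G - {v}"
        using linked_imp_apath[OF l] by blast
      have "p \<noteq> []" using p(1) \<open>u \<noteq> w\<close> by (auto simp: apath_Nil_iff)
      have wv: "(w, v) \<in> parcs G" using arcs_symmetric vw by blast
      have aw: "awalk u p w" using p(1) by (simp add: apath_def)
      have "awalk w [(w, v)] v" using wv by (auto simp: awalk_simps dest: wellformed')
      then have aw2: "awalk u (p @ [(w, v)]) v" using awalk_appendI[OF aw] by blast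
      then have "awalk v ((v, u) # p @ [(w, v)]) v"
        using vu by (auto simp: awalk_Cons_iff dest: wellformed')
      moreover have "awalk_verts u (p @ [(w, v)]) = awalk_verts u p @ [v]"
        using awalk_verts_append[OF aw2] by simp
      then have "distinct (awalk_verts u (p @ [(w, v)]))"
        using p by (auto simp: apath_def)
      then have "distinct (tl (awalk_verts v ((v, u) # p @ [(w, v)])))" by simp
      ultimately have "cycle ((v, u) # p @ [(w, v)])" unfolding cycle_def by blast
      then have "length ((v, u) # p @ [(w, v)]) < 3" by (rule acyc)
      then show False using \<open>p \<noteq> []\<close> by (cases p) auto
    qed
  qed
qed

text \<open>The vertex set of the path from \<open>a\<close> to \<open>b\<close> serves as
  separating set. Since a triple determines only the set \<open>{a, b}\<close>, symmetry of
  \<open>displ\<close> in its first two arguments enters.\<close>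

lemma displays_iff:
  assumes "rooted_tree (G, \<rho>)"
  shows "displays (G, \<rho>) ({a, b}, c) \<longleftrightarrow> distinct [a, b, c] \<and> {a, b, c} \<subseteq> tree_leaves G \<and>
    displayed_rel (pverts G) (parcs G) \<rho> a b c"
proof -
  have "pair_graph G" using assms by (auto simp: rooted_tree_def undirected_tree_def)
  then interpret pair_graph G .
  interpret T: rel_tree "pverts G" "parcs G" \<rho> using assms by (rule rel_tree_rooted_tree)
  have paths: "T.displ a b c \<longleftrightarrow> (\<exists>p q. apath a p b \<and> apath c q \<rho> \<and>
      set (awalk_verts a p) \<inter> set (awalk_verts c q) = {})" for a b c
  proof
    assume "T.displ a b c"
    then obtain S where S: "S \<subseteq> pverts G" "linked (parcs G) S a b" "linked (parcs G) (pverts G - S) c \<rho>"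
      unfolding displayed_rel_def by blast
    obtain p where "apath a p b" "set (awalk_verts a p) \<subseteq> S"
      using linked_imp_apath[OF S(2,1)] by blast
    moreover obtain q where "apath c q \<rho>" "set (awalk_verts c q) \<subseteq> pverts G - S"
      using linked_imp_apath[OF S(3)] by blast
    ultimately show "\<exists>p q. apath a p b \<and> apath c q \<rho> \<and>
      set (awalk_verts a p) \<inter> set (awalk_verts c q) = {}" by blast
  next
    assume "\<exists>p q. apath a p b \<and> apath c q \<rho> \<and>
      set (awalk_verts a p) \<inter> set (awalk_verts c q) = {}"
    then obtain p q where p: "awalk a p b" and q: "awalk c q \<rho>"
      and disj: "set (awalk_verts a p) \<inter> set (awalk_verts c q) = {}" by (auto simp: apath_def)
    have "linked (parcs G) (set (awalk_verts a p)) a b" using awalk_imp_linked[OF p order_refl] .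
    moreover have "set (awalk_verts c q) \<subseteq> pverts G - set (awalk_verts a p)"
      using awalk_verts_subset[OF q] disj by blast
    then have "linked (parcs G) (pverts G - set (awalk_verts a p)) c \<rho>"
      by (rule awalk_imp_linked[OF q])
    moreover have "set (awalk_verts a p) \<subseteq> pverts G" by (rule awalk_verts_subset[OF p])
    ultimately show "T.displ a b c" unfolding displayed_rel_def by blast
  qed
  have swap: "T.displ a b c \<Longrightarrow> T.displ b a c" for a b c
    unfolding displayed_rel_def using T.sym_linked by blast
  have "displays (G, \<rho>) ({a, b}, c) \<longleftrightarrow> (\<exists>a' b'. {a, b} = {a', b'} \<and> distinct [a', b', c] \<and>
    {a', b', c} \<subseteq> tree_leaves G \<and> T.displ a' b' c)"
    unfolding displays_def triple_def paths by auto
  also have "\<dots> \<longleftrightarrow> distinct [a, b, c] \<and> {a, b, c} \<subseteq> tree_leaves G \<and> T.displ a b c"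
    using swap by (auto simp: doubleton_eq_iff)
  finally show ?thesis .
qed

lemma displays_branches:
  assumes T: "rooted_tree (G, \<rho>)" and L: "L \<subseteq> tree_leaves G" "x \<in> L" "y \<in> L" "x \<noteq> y"
  obtains f :: "'v \<Rightarrow> 'v set" where "\<exists>a\<in>L. \<exists>b\<in>L. f a \<noteq> f b"
    "\<And>a b c. a \<in> L \<Longrightarrow> b \<in> L \<Longrightarrow> c \<in> L \<Longrightarrow> displays (G, \<rho>) ({a, b}, c) \<Longrightarrow> f a = f b"
    "\<And>a b c. a \<in> L \<Longrightarrow> b \<in> L \<Longrightarrow> c \<in> L \<Longrightarrow> a \<noteq> b \<Longrightarrow> f a = f b \<Longrightarrow> f a \<noteq> f c \<Longrightarrow>
      displays (G, \<rho>) ({a, b}, c)"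
proof -
  interpret T: rel_tree "pverts G" "parcs G" \<rho> using T by (rule rel_tree_rooted_tree)
  have sub: "L \<subseteq> pverts G" "\<rho> \<notin> L" using L(1) root_not_leaf[OF T] by (auto simp: tree_leaves_def)
  show thesis
  proof (rule T.ex_branches[OF sub L(2-4)])
    fix l u w assume "l \<in> L" "(l, u) \<in> parcs G" "(l, w) \<in> parcs G"
    then show "u = w" using tree_leaf_neighbour[of l G u w] L(1) by blast
  next
    fix f :: "'v \<Rightarrow> 'v set"
    assume f: "\<exists>a\<in>L. \<exists>b\<in>L. f a \<noteq> f b"
      "\<And>a b c. a \<in> L \<Longrightarrow> b \<in> L \<Longrightarrow> c \<in> L \<Longrightarrow> T.displ a b c \<Longrightarrow> f a = f b"
      "\<And>a b c. a \<in> L \<Longrightarrow> b \<in> L \<Longrightarrow> c \<in> L \<Longrightarrow> f a = f b \<Longrightarrow> f a \<noteq> f c \<Longrightarrow> T.displ a b c"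
    show thesis
    proof (rule that[of f])
      show "\<exists>a\<in>L. \<exists>b\<in>L. f a \<noteq> f b" by (rule f(1))
    next
      fix a b c assume *: "a \<in> L" "b \<in> L" "c \<in> L" "displays (G, \<rho>) ({a, b}, c)"
      then show "f a = f b" using f(2)[OF *(1-3)] displays_iff[OF T] by simp
    next
      fix a b c assume *: "a \<in> L" "b \<in> L" "c \<in> L" "a \<noteq> b" "f a = f b" "f a \<noteq> f c"
      have "T.displ a b c" using f(3)[OF *(1-3,5,6)] .
      moreover have "distinct [a, b, c]" using * by auto
      ultimately show "displays (G, \<rho>) ({a, b}, c)" using displays_iff[OF T] * L(1) by auto
    qed
  qed
qed

text \<open>Branch labels are not constant on the three leaves, so at most one pair shares a
  label.\<close>

lemma displays_exclusive:
  assumes "rooted_tree T" "displays T ({x, y}, z)"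
  shows "\<not> displays T ({x, z}, y)" "\<not> displays T ({y, z}, x)"
proof -
  obtain G \<rho> where T: "T = (G, \<rho>)" by (cases T)
  have tree: "rooted_tree (G, \<rho>)" and disp: "displays (G, \<rho>) ({x, y}, z)" using assms T by simp_all
  then have xyz: "distinct [x, y, z]" "{x, y, z} \<subseteq> tree_leaves G"
    by (simp_all add: displays_iff[OF tree])
  have xy: "x \<in> {x, y, z}" "y \<in> {x, y, z}" "x \<noteq> y" using xyz(1) by auto
  have "\<not> displays T ({x, z}, y) \<and> \<not> displays T ({y, z}, x)"
  proof (rule displays_branches[OF tree xyz(2) xy])
    fix f :: "'a \<Rightarrow> 'a set"
    assume f: "\<exists>a\<in>{x, y, z}. \<exists>b\<in>{x, y, z}. f a \<noteq> f b"
      "\<And>a b c. a \<in> {x, y, z} \<Longrightarrow> b \<in> {x, y, z} \<Longrightarrow> c \<in> {x, y, z} \<Longrightarrow>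
        displays (G, \<rho>) ({a, b}, c) \<Longrightarrow> f a = f b"
    have "f x = f y" using f(2)[of x y z] disp by simp
    then show ?thesis using f(1) f(2)[of x z y] f(2)[of y z x] unfolding T by auto
  qed
  then show "\<not> displays T ({x, z}, y)" "\<not> displays T ({y, z}, x)" by simp_all
qed

lemma displays_proper: "displays T t \<Longrightarrow> \<exists>x y z. t = ({x, y}, z) \<and> distinct [x, y, z]"
  unfolding displays_def triple_def by (auto split: prod.splits)

lemma displays_leaves: "displays (G, \<rho>) t \<Longrightarrow> triple_leaves t \<subseteq> tree_leaves G"
  unfolding displays_def triple_def triple_leaves_def by auto

text \<open>Converse of \<open>rel_tree_rooted_tree\<close>: on a cycle of length at least 3 the two
  neighbours of the start vertex differ and are linked off it, against
  \<open>acyclic\<close>.\<close>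

lemma rooted_treeI:
  assumes finite_V: "finite V" and E_sub: "E \<subseteq> V \<times> V" and sym_E: "sym E" and irrefl: "\<And>v. (v, v) \<notin> E"
    and root: "\<rho> \<in> V" "card (E `` {\<rho>}) \<noteq> 1"
    and linked_root: "\<And>v. v \<in> V \<Longrightarrow> linked E V v \<rho>"
    and acyclic: "\<And>v u w. (v, u) \<in> E \<Longrightarrow> (v, w) \<in> E \<Longrightarrow> linked E (V - {v}) u w \<Longrightarrow> u = w"
    and degree: "\<And>v. v \<in> V \<Longrightarrow> v \<noteq> \<rho> \<Longrightarrow> card (E `` {v}) = 1 \<or> card (E `` {v}) \<ge> 3"
  shows "rooted_tree (\<lparr>pverts = V, parcs = E\<rparr>, \<rho>)"
proof -
  let ?G = "\<lparr>pverts = V, parcs = E\<rparr>"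
  have "finite E" using finite_V E_sub finite_subset by blast
  have graph: "pair_graph ?G"
  proof
    show "symmetric (with_proj ?G)" using sym_E by (simp add: symmetric_def)
  qed (use finite_V \<open>finite E\<close> E_sub irrefl in auto)
  then interpret G: pair_graph ?G .
  have conn: "connected (with_proj ?G)"
    unfolding connected_def strongly_connected_def
  proof (intro conjI ballI)
    show "verts (with_proj (mk_symmetric (with_proj ?G))) \<noteq> {}" using root(1) by auto
  next
    fix u v assume "u \<in> verts (with_proj (mk_symmetric (with_proj ?G)))"
      "v \<in> verts (with_proj (mk_symmetric (with_proj ?G)))"
    then have "linked E V u \<rho>" "linked E V \<rho> v" using linked_root linked_sym[OF sym_E] by auto
    then have "linked E V u v" by (rule linked_trans)
    then obtain p where "G.apath u p v" using G.linked_imp_apath[of V u v] by auto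
    then have "u \<rightarrow>\<^sup>*\<^bsub>with_proj ?G\<^esub> v" using G.reachable_apath by blast
    then show "u \<rightarrow>\<^sup>*\<^bsub>with_proj (mk_symmetric (with_proj ?G))\<^esub> v"
      using G.reachable_mk_symmetric_eq[OF G.pair_sym_arcs] by simp
  qed
  have "\<not> 3 \<le> length p" if cycle: "G.cycle p" for p
  proof
    assume len: "3 \<le> length p"
    obtain v where v: "G.awalk v p v" "distinct (tl (G.awalk_verts v p))"
      using cycle unfolding G.cycle_def by blast
    obtain e p1 where p1: "p = e # p1" using len by (cases p) auto
    obtain u where e: "e = (v, u)" using v(1) p1 by (cases e) (auto simp: G.awalk_Cons_iff)
    obtain p2 e' where p2: "p1 = p2 @ [e']" using len p1 by (cases p1 rule: rev_cases) auto
    have aw: "(v, u) \<in> E" "G.awalk u (p2 @ [e']) v"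
      using v(1) p1 e p2 by (auto simp: G.awalk_Cons_iff)
    obtain w where e': "e' = (w, v)" "G.awalk u p2 w" "(w, v) \<in> E"
      using aw(2) by (cases e') (auto simp: G.awalk_Cons_iff G.awalk_Nil_iff)
    have "p2 \<noteq> []" using len p1 p2 by auto
    have verts: "G.awalk_verts u (p2 @ [e']) = G.awalk_verts u p2 @ [v]"
      using G.awalk_verts_append[OF aw(2)] e' by simp
    have dist: "distinct (G.awalk_verts u p2 @ [v])" using v(2) p1 p2 e verts by simp
    then have "G.apath u p2 w" using e'(2) by (simp add: G.apath_def)
    then have "u \<noteq> w" using \<open>p2 \<noteq> []\<close> G.apath_nonempty_ends by blast
    have "set (G.awalk_verts u p2) \<subseteq> V - {v}" using dist G.awalk_verts_subset[OF e'(2)] by auto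
    then have "linked E (V - {v}) u w" using G.awalk_imp_linked[OF e'(2)] by simp
    moreover have "(v, w) \<in> E" using e'(3) sym_E by (auto dest: symD)
    ultimately show False using acyclic[OF aw(1)] \<open>u \<noteq> w\<close> by blast
  qed
  then have "undirected_tree ?G" using graph conn unfolding undirected_tree_def by blast
  then show ?thesis
    using root degree by (auto simp: rooted_tree_def inner_vertices_def tree_leaves_def vertex_degree_eq)
qed

section \<open>Joining planted trees\<close>

text \<open>
  A planted tree has an additional half-edge at its root, so that the root has degree 2, or 0 if
  the tree is a single leaf. The function \<open>f\<close> sends each vertex other than \<open>v\<close> to the neighbour
  of \<open>v\<close> in its direction; its existence makes the graph acyclic.
\<close>
definition planted :: "'v set \<Rightarrow> 'v rel \<Rightarrow> 'v \<Rightarrow> 'v set \<Rightarrow> bool" where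
  "planted V E r L \<longleftrightarrow> finite V \<and> E \<subseteq> V \<times> V \<and> sym E \<and> (\<forall>v. (v, v) \<notin> E) \<and> r \<in> V \<and> L \<subseteq> V \<and>
     (\<forall>v\<in>V. linked E V v r) \<and>
     (\<forall>v\<in>V. \<exists>f. (\<forall>p q. (p, q) \<in> E \<longrightarrow> p \<noteq> v \<longrightarrow> q \<noteq> v \<longrightarrow> f p = f q) \<and>
        (\<forall>u. (v, u) \<in> E \<longrightarrow> f u = u)) \<and>
     (\<forall>v\<in>V. card (E `` {v}) + (if v = r then 1 else 0) = (if v \<in> L then 1 else 3))"

definition join_edges :: "'v rel \<Rightarrow> 'v \<Rightarrow> 'v rel \<Rightarrow> 'v \<Rightarrow> 'v \<Rightarrow> 'v rel" where
  "join_edges E1 r1 E2 r2 r = E1 \<union> E2 \<union> {(r, r1), (r1, r), (r, r2), (r2, r)}"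

text \<open>By this symmetry the lemmas about the left tree also serve the right one.\<close>

lemma join_edges_commute: "join_edges E1 r1 E2 r2 r = join_edges E2 r2 E1 r1 r"
  unfolding join_edges_def by auto

lemma planted_leaf: "planted {l} {} l {l}"
  unfolding planted_def by (auto intro: linked_refl symI)

lemma join_image_left:
  assumes "E1 \<subseteq> V1 \<times> V1" "E2 \<subseteq> V2 \<times> V2" "V1 \<inter> V2 = {}" "r \<notin> V1 \<union> V2" "r1 \<in> V1" "r2 \<in> V2" "v \<in> V1"
  shows "join_edges E1 r1 E2 r2 r `` {v} = E1 `` {v} \<union> (if v = r1 then {r} else {})"
  using assms unfolding join_edges_def by auto

lemma join_projection_left:
  assumes "E1 \<subseteq> V1 \<times> V1" "E2 \<subseteq> V2 \<times> V2" "V1 \<inter> V2 = {}" "r \<notin> V1 \<union> V2" "r1 \<in> V1" "r2 \<in> V2" "v \<in> V1"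
    and f: "\<forall>p q. (p, q) \<in> E1 \<longrightarrow> p \<noteq> v \<longrightarrow> q \<noteq> v \<longrightarrow> f p = f q" "\<forall>u. (v, u) \<in> E1 \<longrightarrow> f u = u"
  shows "\<exists>f. (\<forall>p q. (p, q) \<in> join_edges E1 r1 E2 r2 r \<longrightarrow> p \<noteq> v \<longrightarrow> q \<noteq> v \<longrightarrow> f p = f q) \<and>
    (\<forall>u. (v, u) \<in> join_edges E1 r1 E2 r2 r \<longrightarrow> f u = u)"
proof (intro exI conjI allI impI)
  \<comment> \<open>Seen from \<open>v\<close>, the new root and the whole second tree lie in the
    direction of \<open>r1\<close>, or of \<open>r\<close> if \<open>v\<close> is \<open>r1\<close>
    itself.\<close>
  let ?f = "\<lambda>p. if p \<in> V1 then f p else if v = r1 then r else f r1"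
  show "?f p = ?f q" if pq: "(p, q) \<in> join_edges E1 r1 E2 r2 r" "p \<noteq> v" "q \<noteq> v" for p q
  proof -
    consider "(p, q) \<in> E1" | "(p, q) \<in> E2" | "p = r" "q = r1" | "p = r1" "q = r" | "p = r" "q = r2" | "p = r2" "q = r"
      using pq(1) unfolding join_edges_def by blast
    then show ?thesis
    proof cases
      case 1
      then have "f p = f q" using f(1) pq(2,3) by blast
      then show ?thesis using 1 assms(1) by auto
    next
      case 2
      then have "p \<notin> V1" "q \<notin> V1" using assms(2,3) by auto
      then show ?thesis by simp
    qed (use assms(3-7) pq(2,3) in auto)
  qed
  show "?f u = u" if "(v, u) \<in> join_edges E1 r1 E2 r2 r" for u
  proof -
    have "(v, u) \<in> E1 \<or> (v = r1 \<and> u = r)"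
      using that assms(2-7) unfolding join_edges_def by auto
    then show ?thesis using f(2) assms(1,4) by auto
  qed
qed

lemma join_linked_left:
  assumes "planted V1 E1 r1 L1" "v \<in> V1"
  shows "linked (join_edges E1 r1 E2 r2 r) (insert r V1) v r"
proof -
  let ?E = "join_edges E1 r1 E2 r2 r"
  have v: "linked E1 V1 v r1" and r1: "r1 \<in> V1" using assms by (auto simp: planted_def)
  have "linked ?E (insert r V1) v r1" using v by (rule linked_mono) (auto simp: join_edges_def)
  moreover have "linked ?E (insert r V1) r1 r"
    using r1 by (intro linked_edge) (auto simp: join_edges_def)
  ultimately show ?thesis by (rule linked_trans)
qed

text \<open>The half-edges at \<open>r1\<close> and \<open>r2\<close> become edges to
  \<open>r\<close>, so the counts there are unchanged; \<open>r\<close> has two edges and a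
  half-edge of its own, again 3.\<close>

lemma planted_join:
  assumes T1: "planted V1 E1 r1 L1" and T2: "planted V2 E2 r2 L2"
    and disj: "V1 \<inter> V2 = {}" and r: "r \<notin> V1 \<union> V2"
  shows "planted (insert r (V1 \<union> V2)) (join_edges E1 r1 E2 r2 r) r (L1 \<union> L2)"
proof -
  let ?E = "join_edges E1 r1 E2 r2 r" and ?V = "insert r (V1 \<union> V2)"
  have E: "E1 \<subseteq> V1 \<times> V1" "E2 \<subseteq> V2 \<times> V2" and rs: "r1 \<in> V1" "r2 \<in> V2" and Ls: "L1 \<subseteq> V1" "L2 \<subseteq> V2"
    and fin: "finite V1" "finite V2" and sym: "sym E1" "sym E2"
    and irr: "\<forall>v. (v, v) \<notin> E1" "\<forall>v. (v, v) \<notin> E2"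
    using T1 T2 by (auto simp: planted_def)
  have disj': "V2 \<inter> V1 = {}" and r': "r \<notin> V2 \<union> V1" using disj r by auto
  note left = E disj r rs
  note right = E(2,1) disj' r' rs(2,1)
  have finE: "finite (E1 `` {v})" "finite (E2 `` {v})" for v
    using finite_subset[OF _ fin(1), of "E1 `` {v}"] finite_subset[OF _ fin(2), of "E2 `` {v}"] E by auto
  have lnk: "linked ?E ?V v r" if v: "v \<in> ?V" for v
  proof -
    consider "v = r" | "v \<in> V1" | "v \<in> V2" using v by blast
    then show ?thesis
    proof cases
      case 1
      then show ?thesis by (simp add: linked_refl)
    next
      case 2
      show ?thesis using join_linked_left[OF T1 2] by (rule linked_mono) auto
    next
      case 3
      show ?thesis
        unfolding join_edges_commute[of E1 r1]
        using join_linked_left[OF T2 3] by (rule linked_mono) auto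
    qed
  qed
  have proj: "\<exists>f. (\<forall>p q. (p, q) \<in> ?E \<longrightarrow> p \<noteq> v \<longrightarrow> q \<noteq> v \<longrightarrow> f p = f q) \<and>
      (\<forall>u. (v, u) \<in> ?E \<longrightarrow> f u = u)" if v: "v \<in> ?V" for v
  proof -
    consider "v = r" | "v \<in> V1" | "v \<in> V2" using v by blast
    then show ?thesis
    proof cases
      case 1
      show ?thesis
      proof (intro exI conjI allI impI)
        let ?f = "\<lambda>p. if p \<in> V1 then r1 else r2"
        show "?f p = ?f q" if "(p, q) \<in> ?E" "p \<noteq> v" "q \<noteq> v" for p q
        proof -
          have "(p, q) \<in> E1 \<or> (p, q) \<in> E2" using that 1 unfolding join_edges_def by auto
          then show ?thesis using E disj by auto
        qed
        show "?f u = u" if "(v, u) \<in> ?E" for u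
          using that 1 E r rs disj unfolding join_edges_def by auto
      qed
    next
      case 2
      then obtain f where "\<forall>p q. (p, q) \<in> E1 \<longrightarrow> p \<noteq> v \<longrightarrow> q \<noteq> v \<longrightarrow> f p = f q"
        "\<forall>u. (v, u) \<in> E1 \<longrightarrow> f u = u"
        using T1 unfolding planted_def by blast
      then show ?thesis by (rule join_projection_left[OF left 2])
    next
      case 3
      then obtain f where "\<forall>p q. (p, q) \<in> E2 \<longrightarrow> p \<noteq> v \<longrightarrow> q \<noteq> v \<longrightarrow> f p = f q"
        "\<forall>u. (v, u) \<in> E2 \<longrightarrow> f u = u"
        using T2 unfolding planted_def by blast
      then show ?thesis
        unfolding join_edges_commute[of E1 r1] by (rule join_projection_left[OF right 3])
    qed
  qed
  have deg: "card (?E `` {v}) + (if v = r then 1 else 0) = (if v \<in> L1 \<union> L2 then 1 else 3)"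
    if v: "v \<in> ?V" for v
  proof -
    consider "v = r" | "v \<in> V1" | "v \<in> V2" using v by blast
    then show ?thesis
    proof cases
      case 1
      have "?E `` {r} = {r1, r2}" using E r unfolding join_edges_def by auto
      moreover have "r1 \<noteq> r2" using rs disj by blast
      ultimately show ?thesis using 1 r Ls by auto
    next
      case 2
      have "card (?E `` {v}) = card (E1 `` {v}) + (if v = r1 then 1 else 0)"
        unfolding join_image_left[OF left 2] using finE(1) E(1) r by (auto simp: card_insert_if)
      moreover have "v \<notin> L2" "v \<noteq> r" using 2 Ls disj r by auto
      moreover have "card (E1 `` {v}) + (if v = r1 then 1 else 0) = (if v \<in> L1 then 1 else 3)"
        using T1 2 unfolding planted_def by blast
      ultimately show ?thesis by simp
    next
      case 3
      have "card (?E `` {v}) = card (E2 `` {v}) + (if v = r2 then 1 else 0)"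
        unfolding join_edges_commute[of E1 r1] join_image_left[OF right 3]
        using finE(2) E(2) r by (auto simp: card_insert_if)
      moreover have "v \<notin> L1" "v \<noteq> r" using 3 Ls disj r by auto
      moreover have "card (E2 `` {v}) + (if v = r2 then 1 else 0) = (if v \<in> L2 then 1 else 3)"
        using T2 3 unfolding planted_def by blast
      ultimately show ?thesis by simp
    qed
  qed
  have symE: "sym ?E" using sym unfolding join_edges_def sym_def by blast
  have irrE: "\<forall>v. (v, v) \<notin> ?E" using irr r rs unfolding join_edges_def by auto
  have subE: "?E \<subseteq> ?V \<times> ?V" using E rs unfolding join_edges_def by auto
  have "finite ?V" "r \<in> ?V" "L1 \<union> L2 \<subseteq> ?V" using fin Ls by auto
  then show ?thesis
    unfolding planted_def using subE symE irrE lnk proj deg by (intro conjI ballI)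
qed

text \<open>For \<open>c\<close> in the same tree the old separating set still works, with the path
  prolonged to \<open>r\<close>. For \<open>c\<close> in the other tree all of \<open>V1\<close>
  separates.\<close>

lemma displayed_join_left:
  assumes T1: "planted V1 E1 r1 L1" and T2: "planted V2 E2 r2 L2"
    and disj: "V1 \<inter> V2 = {}" and r: "r \<notin> V1 \<union> V2"
    and ab: "a \<in> V1" "b \<in> V1" and c: "c \<in> V1 \<Longrightarrow> displayed_rel V1 E1 r1 a b c" "c \<in> V1 \<union> V2"
  shows "displayed_rel (insert r (V1 \<union> V2)) (join_edges E1 r1 E2 r2 r) r a b c"
proof -
  let ?E = "join_edges E1 r1 E2 r2 r" and ?V = "insert r (V1 \<union> V2)"
  show ?thesis
  proof (cases "c \<in> V1")
    case True
    then obtain S where S: "S \<subseteq> V1" "linked E1 S a b" "linked E1 (V1 - S) c r1"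
      using c(1) unfolding displayed_rel_def by blast
    have "linked ?E S a b" using S(2) by (rule linked_mono) (auto simp: join_edges_def)
    moreover have "linked ?E (?V - S) c r1"
      using S(3) by (rule linked_mono) (auto simp: join_edges_def)
    moreover have "linked ?E (?V - S) r1 r"
      using linked_in(2)[OF S(3)] S(1) r by (intro linked_edge) (auto simp: join_edges_def)
    moreover have "S \<subseteq> ?V" using S(1) by blast
    ultimately show ?thesis unfolding displayed_rel_def using linked_trans by metis
  next
    case False
    then have "c \<in> V2" using c(2) by blast
    have "linked E1 V1 a r1" "linked E1 V1 r1 b"
      using T1 ab linked_sym[of E1] unfolding planted_def by blast+
    then have "linked E1 V1 a b" by (rule linked_trans)
    then have "linked ?E V1 a b" by (rule linked_mono) (auto simp: join_edges_def)
    moreover have "linked ?E (?V - V1) c r"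
      unfolding join_edges_commute[of E1 r1]
      using join_linked_left[OF T2 \<open>c \<in> V2\<close>] by (rule linked_mono) (use disj r in auto)
    moreover have "V1 \<subseteq> ?V" by blast
    ultimately show ?thesis unfolding displayed_rel_def by blast
  qed
qed

text \<open>BUILD with binary splits: one Aho component against all the rest. A triple inside
  \<open>L\<close> has its pair on one side; if its third leaf is on the other side, the join
  displays it without further conditions.\<close>

lemma ex_planted:
  fixes S :: "'v::infinite triple set"
  assumes disc: "aho_disconnected S" and proper: "proper_triples S"
    and "finite L" "L \<noteq> {}" "finite F" "F \<inter> L = {}"
  shows "\<exists>V E r. planted V E r L \<and> V \<inter> F = {} \<and>
    (\<forall>a b c. ({a, b}, c) \<in> S \<longrightarrow> {a, b, c} \<subseteq> L \<longrightarrow> displayed_rel V E r a b c)"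
  using assms(3-)
proof (induction L arbitrary: F rule: finite_psubset_induct)
  case (psubset L)
  show ?case
  proof (cases "\<exists>x y. x \<in> L \<and> y \<in> L \<and> x \<noteq> y")
    case False
    then obtain l where L: "L = {l}" using psubset.prems(1) by blast
    have "\<not> {a, b, c} \<subseteq> L" if "({a, b}, c) \<in> S" for a b c
      using that proper L unfolding proper_triples_def by (fastforce simp: doubleton_eq_iff)
    then show ?thesis using planted_leaf[of l] L psubset.prems(3) by blast
  next
    case True
    then obtain u v where uv: "u \<in> L" "v \<in> L" "\<not> joined S L u v"
      using disc unfolding aho_disconnected_def by meson
    define L1 where "L1 = {w \<in> L. joined S L u w}"
    define L2 where "L2 = L - L1"
    have parts: "L = L1 \<union> L2" "L1 \<inter> L2 = {}" "u \<in> L1" "v \<in> L2"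
      using uv by (auto simp: L1_def L2_def)
    have psub: "L1 \<subset> L" "L2 \<subset> L" using parts by blast+
    have fin: "finite L1" "finite L2" using psub psubset.hyps finite_subset by blast+
    have split: "({a, b} \<subseteq> L1) \<or> ({a, b} \<subseteq> L2)" if t: "({a, b}, c) \<in> S" "{a, b, c} \<subseteq> L" for a b c
    proof -
      have ab: "joined S L a b" using t by (intro joined_triple) auto
      have "joined S L u a \<longleftrightarrow> joined S L u b"
        using joined_trans[OF _ ab] joined_trans[OF _ joined_sym[OF ab]] by blast
      then show ?thesis using t(2) unfolding L1_def L2_def by blast
    qed
    \<comment> \<open>The forbidden set keeps the two trees disjoint: the first avoids the leaves of
      the second, and the second will avoid all of the first.\<close>
    have "L1 \<noteq> {}" "finite (F \<union> L2)" "(F \<union> L2) \<inter> L1 = {}"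
      using fin psubset.prems parts by auto
    from psubset.IH[OF psub(1) this] obtain V1 E1 r1 where T1: "planted V1 E1 r1 L1" "V1 \<inter> (F \<union> L2) = {}"
      and D1: "\<And>a b c. ({a, b}, c) \<in> S \<Longrightarrow> {a, b, c} \<subseteq> L1 \<Longrightarrow> displayed_rel V1 E1 r1 a b c"
      by blast
    have V1: "finite V1" "L1 \<subseteq> V1" using T1(1) by (auto simp: planted_def)
    have "L2 \<noteq> {}" "finite (F \<union> V1)" "(F \<union> V1) \<inter> L2 = {}"
      using V1 T1(2) psubset.prems parts by auto
    from psubset.IH[OF psub(2) this] obtain V2 E2 r2 where T2: "planted V2 E2 r2 L2" "V2 \<inter> (F \<union> V1) = {}"
      and D2: "\<And>a b c. ({a, b}, c) \<in> S \<Longrightarrow> {a, b, c} \<subseteq> L2 \<Longrightarrow> displayed_rel V2 E2 r2 a b c"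
      by blast
    have V2: "finite V2" "L2 \<subseteq> V2" using T2(1) by (auto simp: planted_def)
    have disj: "V1 \<inter> V2 = {}" "V2 \<inter> V1 = {}" using T2(2) by auto
    obtain r where r: "r \<notin> F \<union> V1 \<union> V2"
      using ex_new_if_finite[OF infinite_UNIV, of "F \<union> V1 \<union> V2"] psubset.prems(2) V1(1) V2(1) by auto
    let ?V = "insert r (V1 \<union> V2)" and ?E = "join_edges E1 r1 E2 r2 r"
    have "planted ?V ?E r L"
      using planted_join[OF T1(1) T2(1) disj(1)] r parts(1) by auto
    moreover have "?V \<inter> F = {}" using T1(2) T2(2) r by auto
    moreover have "displayed_rel ?V ?E r a b c" if t: "({a, b}, c) \<in> S" "{a, b, c} \<subseteq> L" for a b c
    proof (cases "{a, b} \<subseteq> L1")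
      case True
      show ?thesis
      proof (rule displayed_join_left[OF T1(1) T2(1) disj(1)])
        assume "c \<in> V1"
        then have "c \<in> L1" using t(2) V2(2) disj parts(1) by auto
        then show "displayed_rel V1 E1 r1 a b c" using D1[OF t(1)] True by auto
      qed (use True t(2) V1(2) V2(2) parts(1) r in auto)
    next
      case False
      then have ab: "{a, b} \<subseteq> L2" using split[OF t] by blast
      have "displayed_rel (insert r (V2 \<union> V1)) (join_edges E2 r2 E1 r1 r) r a b c"
      proof (rule displayed_join_left[OF T2(1) T1(1) disj(2)])
        assume "c \<in> V2"
        then have "c \<in> L2" using t(2) V1(2) disj parts(1) by auto
        then show "displayed_rel V2 E2 r2 a b c" using D2[OF t(1)] ab by auto
      qed (use ab t(2) V1(2) V2(2) parts(1) r in auto)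
      then show ?thesis by (simp add: Un_commute join_edges_commute)
    qed
    ultimately show ?thesis by blast
  qed
qed

section \<open>The closure in terms of Aho graphs\<close>

text \<open>Without its half-edge the root has degree 2, which only a root may have. With two leaves
  the root cannot be one of them, for it would have degree 0.\<close>

lemma planted_imp_rooted_tree:
  assumes T: "planted V E r L" and two: "x \<in> L" "y \<in> L" "x \<noteq> y"
  shows "rooted_tree (\<lparr>pverts = V, parcs = E\<rparr>, r)" "tree_leaves \<lparr>pverts = V, parcs = E\<rparr> = L"
proof -
  have fin: "finite V" and E: "E \<subseteq> V \<times> V" "sym E" "\<And>v. (v, v) \<notin> E" and r: "r \<in> V" and L: "L \<subseteq> V"
    and lnk: "\<And>v. v \<in> V \<Longrightarrow> linked E V v r"
    and proj: "\<And>v. v \<in> V \<Longrightarrow> \<exists>f. (\<forall>p q. (p, q) \<in> E \<longrightarrow> p \<noteq> v \<longrightarrow> q \<noteq> v \<longrightarrow> f p = f q) \<and>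
        (\<forall>u. (v, u) \<in> E \<longrightarrow> f u = u)"
    and deg: "\<And>v. v \<in> V \<Longrightarrow> card (E `` {v}) + (if v = r then 1 else 0) = (if v \<in> L then 1 else 3)"
    using T unfolding planted_def by blast+
  have "r \<notin> L"
  proof
    assume "r \<in> L"
    obtain l where l: "l \<in> L" "l \<noteq> r" using two by metis
    have "linked E V r l" using linked_sym[OF E(2) lnk] l(1) L by blast
    then have "linked E V r l \<and> (l = r \<or> (\<exists>w. (r, w) \<in> E))"
      by (induction rule: linked_induct) (auto intro: linked_refl dest: linked_trans[OF _ linked_edge])
    then obtain w where "(r, w) \<in> E" using l(2) by blast
    moreover have "finite (E `` {r})" using fin E(1) finite_subset[of "E `` {r}" V] by auto
    ultimately have "card (E `` {r}) \<noteq> 0" by auto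
    then show False using deg[OF r] \<open>r \<in> L\<close> by simp
  qed
  show "rooted_tree (\<lparr>pverts = V, parcs = E\<rparr>, r)"
  proof (rule rooted_treeI[OF fin E r _ lnk])
    show "card (E `` {r}) \<noteq> 1" using deg[OF r] \<open>r \<notin> L\<close> by simp
  next
    fix v u w assume vu: "(v, u) \<in> E" "(v, w) \<in> E" and uw: "linked E (V - {v}) u w"
    obtain f where f: "\<forall>p q. (p, q) \<in> E \<longrightarrow> p \<noteq> v \<longrightarrow> q \<noteq> v \<longrightarrow> f p = f q" "\<forall>u. (v, u) \<in> E \<longrightarrow> f u = u"
      using proj vu(1) E(1) by blast
    \<comment> \<open>The projection at \<open>v\<close> is constant along paths off
      \<open>v\<close> and fixes the neighbours of \<open>v\<close>.\<close>
    have "f u = f w"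
      using uw by (induction rule: linked_induct) (use f(1) in auto)
    then show "u = w" using f(2) vu by simp
  next
    fix v assume "v \<in> V" "v \<noteq> r"
    then show "card (E `` {v}) = 1 \<or> 3 \<le> card (E `` {v})" using deg[of v] by (auto split: if_splits)
  qed
  show "tree_leaves \<lparr>pverts = V, parcs = E\<rparr> = L"
  proof (intro set_eqI iffI)
    fix v assume "v \<in> tree_leaves \<lparr>pverts = V, parcs = E\<rparr>"
    then show "v \<in> L" using deg[of v] by (auto simp: tree_leaves_def vertex_degree_eq split: if_splits)
  next
    fix v assume "v \<in> L"
    then show "v \<in> tree_leaves \<lparr>pverts = V, parcs = E\<rparr>"
      using deg[of v] L \<open>r \<notin> L\<close> by (auto simp: tree_leaves_def vertex_degree_eq split: if_splits)
  qed
qed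

text \<open>Guarantees that \<open>cl S\<close> is not an intersection over no trees. For the empty
  set the witness is a lone root, which has degree 0 and so is no leaf.\<close>

lemma span_nonempty:
  fixes S :: "'v::infinite triple set"
  assumes disc: "aho_disconnected S" and proper: "proper_triples S" and fin: "finite S"
  shows "\<exists>T. T \<in> triple_span S"
proof (cases "S = {}")
  case True
  fix v :: 'v
  have deg: "vertex_degree \<lparr>pverts = {v}, parcs = {}\<rparr> u = 0" for u by (simp add: vertex_degree_eq)
  have "rooted_tree (\<lparr>pverts = {v}, parcs = {}\<rparr>, v)"
    by (rule rooted_treeI) (auto intro: linked_refl symI)
  then have "(\<lparr>pverts = {v}, parcs = {}\<rparr>, v) \<in> triple_span S"
    using True by (simp add: triple_span_def leaf_set_def tree_leaves_def deg)
  then show ?thesis by blast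
next
  case False
  then obtain s where "s \<in> S" by blast
  then obtain x y z where xyz: "({x, y}, z) \<in> S" "distinct [x, y, z]"
    using proper unfolding proper_triples_def by metis
  have tl: "triple_leaves t \<subseteq> leaf_set S" if "t \<in> S" for t
    using that by (auto simp: leaf_set_def)
  have xyL: "x \<in> leaf_set S" "y \<in> leaf_set S" "x \<noteq> y"
    using tl[OF xyz(1)] xyz(2) by (auto simp: triple_leaves_def)
  have "finite (triple_leaves t)" if "t \<in> S" for t
    using that proper unfolding proper_triples_def by (force simp: triple_leaves_def)
  then have finL: "finite (leaf_set S)" using fin by (simp add: leaf_set_def)
  have ne: "leaf_set S \<noteq> {}" using xyL(1) by blast
  obtain V E r where T: "planted V E r (leaf_set S)"
    and D: "\<And>a b c. ({a, b}, c) \<in> S \<Longrightarrow> {a, b, c} \<subseteq> leaf_set S \<Longrightarrow> displayed_rel V E r a b c"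
    using ex_planted[OF disc proper finL ne finite.emptyI Int_empty_left] by blast
  let ?G = "\<lparr>pverts = V, parcs = E\<rparr>"
  note tree = planted_imp_rooted_tree[OF T xyL]
  have "displays (?G, r) t" if t: "t \<in> S" for t
  proof -
    obtain a b c where abc: "t = ({a, b}, c)" "distinct [a, b, c]"
      using proper t unfolding proper_triples_def by blast
    have sub: "{a, b, c} \<subseteq> leaf_set S" using tl[OF t] by (auto simp: abc(1) triple_leaves_def)
    have "displayed_rel V E r a b c" using D[OF _ sub] t abc(1) by blast
    then show ?thesis
      unfolding abc(1) displays_iff[OF tree(1)] using abc(2) sub tree(2) by simp
  qed
  then show ?thesis using tree unfolding triple_span_def by force
qed

text \<open>On leaves of \<open>T\<close>, branch labels are constant on Aho components but not on
  \<open>L\<close>. A point of \<open>L\<close> that is no leaf is isolated.\<close>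

lemma aho_disconnected_displayed:
  fixes S :: "'v triple set"
  assumes T: "rooted_tree T" and S: "\<forall>t\<in>S. displays T t"
  shows "aho_disconnected S"
  unfolding aho_disconnected_def
proof (intro allI impI)
  fix L :: "'v set" and x y assume xy: "x \<in> L" "y \<in> L" "x \<noteq> y"
  obtain G \<rho> where T_eq: "T = (G, \<rho>)" by (cases T)
  have tree: "rooted_tree (G, \<rho>)" using T T_eq by simp
  show "\<exists>u\<in>L. \<exists>v\<in>L. \<not> joined S L u v"
  proof (cases "L \<subseteq> tree_leaves G")
    case True
    show ?thesis
    proof (rule displays_branches[OF tree True xy])
      fix f :: "'v \<Rightarrow> 'v set"
      assume f: "\<exists>a\<in>L. \<exists>b\<in>L. f a \<noteq> f b"
        "\<And>a b c. a \<in> L \<Longrightarrow> b \<in> L \<Longrightarrow> c \<in> L \<Longrightarrow> displays (G, \<rho>) ({a, b}, c) \<Longrightarrow> f a = f b"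
      have "f u = f v" if "joined S L u v" for u v
        using that unfolding joined_def
        by (induction rule: rtrancl_induct) (use f(2) S T_eq in \<open>auto simp: aho_graph_def\<close>)
      then show ?thesis using f(1) by blast
    qed
  next
    case False
    then obtain v where v: "v \<in> L" "v \<notin> tree_leaves G" by blast
    obtain u where u: "u \<in> L" "u \<noteq> v" using xy by metis
    have "(w, v) \<notin> aho_graph S L" for w
    proof
      assume "(w, v) \<in> aho_graph S L"
      then obtain r where "({w, v}, r) \<in> S" unfolding aho_graph_def by blast
      then have "triple_leaves ({w, v}, r) \<subseteq> tree_leaves G"
        using S T_eq by (intro displays_leaves) auto
      then show False using v(2) by (simp add: triple_leaves_def)
    qed
    then have "\<not> joined S L u v" using joined_isolated[of S L u v] u(2) by blast
    then show ?thesis using u(1) v(1) by blast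
  qed
qed

text \<open>Branch labels are constant on the components of \<open>x\<close> and \<open>z\<close>
  but not on \<open>L\<close>, so these two components carry different labels.\<close>

lemma displays_inferred:
  fixes S :: "'v triple set"
  assumes T: "rooted_tree T" and S: "\<forall>t\<in>S. displays T t" and t: "({x, y}, z) \<in> inferred S"
  shows "displays T ({x, y}, z)"
proof -
  obtain G \<rho> where T_eq: "T = (G, \<rho>)" by (cases T)
  have tree: "rooted_tree (G, \<rho>)" using T T_eq by simp
  have disc: "aho_disconnected S" using T S by (rule aho_disconnected_displayed)
  obtain L where L: "distinct [x, y, z]" "x \<in> L" "y \<in> L" "z \<in> L" "joined S L x y"
    "\<And>v. v \<in> L \<Longrightarrow> joined S L v x \<or> joined S L v z"
    using inferredE[OF t] by blast
  have leaves: "triple_leaves t \<subseteq> tree_leaves G" if "t \<in> S" for t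
    using displays_leaves[of G \<rho> t] S T_eq that by blast
  have isolated: "u = v" if v: "v \<notin> tree_leaves G" and uv: "joined S L u v" for u v
  proof (rule joined_isolated[OF uv])
    fix w
    show "(w, v) \<notin> aho_graph S L"
      using leaves v unfolding aho_graph_def triple_leaves_def by fastforce
  qed
  have "L \<subseteq> tree_leaves G"
  proof
    fix v assume v: "v \<in> L"
    show "v \<in> tree_leaves G"
    proof (rule ccontr)
      assume nv: "v \<notin> tree_leaves G"
      \<comment> \<open>A point that is no leaf is isolated, whereas \<open>x\<close> is joined to
        \<open>y\<close>. Only \<open>z\<close> is left, and then \<open>L - {z}\<close> would be
        connected.\<close>
      have "v \<noteq> x"
        using isolated[of x y] isolated[OF nv, of y] L(1,5) joined_sym[OF L(5)] nv by auto
      then have "v = z"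
        using L(6)[OF v] isolated[OF nv, of x] isolated[OF nv, of z] joined_sym[of S L v] by auto
      have "aho_graph S L \<subseteq> aho_graph S (L - {z})"
        using leaves nv \<open>v = z\<close> unfolding aho_graph_def triple_leaves_def by fastforce
      then have up: "joined S (L - {z}) p q" if "joined S L p q" for p q
        using that rtrancl_mono unfolding joined_def by blast
      have "joined S (L - {z}) w x" if w: "w \<in> L - {z}" for w
      proof -
        have "\<not> joined S L w z" using isolated[of z w] nv w \<open>v = z\<close> by auto
        then show ?thesis using L(6)[of w] w up by auto
      qed
      then show False
        using aho_disconnectedD[OF disc, of x "L - {z}" y] L(1-3) by auto
    qed
  qed
  moreover have xy: "x \<noteq> y" using L(1) by simp
  ultimately show ?thesis
    unfolding T_eq
  proof (rule displays_branches[OF tree _ L(2,3)])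
    fix f :: "'v \<Rightarrow> 'v set"
    assume f: "\<exists>a\<in>L. \<exists>b\<in>L. f a \<noteq> f b"
      "\<And>a b c. a \<in> L \<Longrightarrow> b \<in> L \<Longrightarrow> c \<in> L \<Longrightarrow> displays (G, \<rho>) ({a, b}, c) \<Longrightarrow> f a = f b"
      "\<And>a b c. a \<in> L \<Longrightarrow> b \<in> L \<Longrightarrow> c \<in> L \<Longrightarrow> a \<noteq> b \<Longrightarrow> f a = f b \<Longrightarrow> f a \<noteq> f c \<Longrightarrow>
        displays (G, \<rho>) ({a, b}, c)"
    have const: "f u = f v" if "joined S L u v" for u v
      using that unfolding joined_def
      by (induction rule: rtrancl_induct) (use f(2) S T_eq in \<open>auto simp: aho_graph_def\<close>)
    have two: "f v = f x \<or> f v = f z" if "v \<in> L" for v using L(6)[OF that] const by blast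
    have "f x \<noteq> f z" using f(1) two by metis
    then show "displays (G, \<rho>) ({x, y}, z)" using f(3)[OF L(2-4) xy const[OF L(5)]] by blast
  qed
qed

text \<open>If a triple of the closure were not inferred, a competing triple could be added, and a
  tree for the enlarged set would display both.\<close>

lemma cl_eq_inferred:
  fixes S :: "'v::infinite triple set"
  assumes "consistent S"
  shows "cl S = inferred S"
proof -
  obtain T0 where T0: "rooted_tree T0" "\<forall>t\<in>S. displays T0 t"
    using assms unfolding consistent_def by blast
  have disc: "aho_disconnected S" using T0 by (rule aho_disconnected_displayed)
  have proper: "proper_triples S" unfolding proper_triples_def using T0(2) displays_proper by blast
  have fin: "finite S" using assms by (rule consistent_imp_finite)
  show ?thesis
  proof
    show "inferred S \<subseteq> cl S"
    proof
      fix t assume t: "t \<in> inferred S"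
      then obtain x y z where xyz: "t = ({x, y}, z)" unfolding inferred_def by blast
      have "displays T t" if "T \<in> triple_span S" for T
        using displays_inferred[of T S x y z] t that unfolding xyz triple_span_def by simp
      then show "t \<in> cl S" unfolding cl_def displayed_triples_def by simp
    qed
  next
    show "cl S \<subseteq> inferred S"
    proof
      fix t assume t: "t \<in> cl S"
      \<comment> \<open>One tree of the span shows that \<open>t\<close> is a proper triple with
        leaves in \<open>leaf_set S\<close>.\<close>
      obtain T where T: "T \<in> triple_span S" using span_nonempty[OF disc proper fin] by blast
      have disp: "displays T t" using t T unfolding cl_def displayed_triples_def by blast
      then obtain x y z where xyz: "t = ({x, y}, z)" "distinct [x, y, z]"
        using displays_proper by blast
      have "triple_leaves t \<subseteq> leaf_set S"
        using displays_leaves[of "fst T" "snd T" t] disp T by (simp add: triple_span_def)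
      then have leaves: "{x, y, z} \<subseteq> leaf_set S" using xyz(1) by (auto simp: triple_leaves_def)
      show "t \<in> inferred S"
      proof (rule ccontr)
        assume "t \<notin> inferred S"
        then consider "aho_disconnected (insert ({x, z}, y) S)" | "aho_disconnected (insert ({y, z}, x) S)"
          using inferred_total[OF disc xyz(2)] xyz(1) by blast
        then obtain t' where t': "t' = ({x, z}, y) \<or> t' = ({y, z}, x)" "aho_disconnected (insert t' S)"
          by cases auto
        have "distinct [x, z, y]" "distinct [y, z, x]" using xyz(2) by auto
        then have "proper_triples (insert t' S)"
          using proper t'(1) unfolding proper_triples_def by blast
        then obtain T' where T': "T' \<in> triple_span (insert t' S)"
          using span_nonempty[OF t'(2)] fin by auto
        \<comment> \<open>\<open>t'\<close> brings no new leaf, so \<open>T'\<close> also belongs to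
          the span of \<open>S\<close>.\<close>
        have "triple_leaves t' = {x, y, z}" using t'(1) by (auto simp: triple_leaves_def)
        moreover have "leaf_set (insert t' S) = triple_leaves t' \<union> leaf_set S"
          by (simp add: leaf_set_def)
        ultimately have "leaf_set (insert t' S) = leaf_set S"
          using Un_absorb1[OF leaves] by simp
        then have T'S: "T' \<in> triple_span S" "displays T' t'" "rooted_tree T'"
          using T' by (simp_all add: triple_span_def)
        then have "displays T' ({x, y}, z)"
          using t xyz(1) by (simp add: cl_def displayed_triples_def)
        then show False using displays_exclusive[OF T'S(3)] T'S(2) t'(1) by blast
      qed
    qed
  qed
qed

section \<open>Representative sets as generating sets\<close>

lemma consistent_subset: "consistent R \<Longrightarrow> S \<subseteq> R \<Longrightarrow> consistent S"
  unfolding consistent_def by blast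

lemma subset_cl: "S \<subseteq> cl S"
  unfolding cl_def displayed_triples_def triple_span_def by blast

text \<open>Besides displaying \<open>Y\<close>, the tree must have the right leaf set. It yields
  one inclusion of the leaf sets; the other needs some tree in the span of \<open>Y\<close>, which
  consistency provides.\<close>

lemma span_antimono_cl:
  fixes X Y :: "'v::infinite triple set"
  assumes "consistent Y" "X \<subseteq> cl Y" "Y \<subseteq> cl X"
  shows "triple_span X \<subseteq> triple_span Y"
proof
  fix T assume T: "T \<in> triple_span X"
  obtain T0 where T0: "rooted_tree T0" "\<forall>t\<in>Y. displays T0 t"
    using assms(1) unfolding consistent_def by blast
  have "\<exists>T'. T' \<in> triple_span Y"
    using span_nonempty[OF aho_disconnected_displayed[OF T0] _ consistent_imp_finite[OF assms(1)]]
      T0(2) displays_proper unfolding proper_triples_def by blast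
  then obtain T' where T': "T' \<in> triple_span Y" by blast
  have TY: "\<forall>t\<in>Y. displays T t"
    using T assms(3) unfolding cl_def displayed_triples_def by blast
  have TX: "\<forall>t\<in>X. displays T' t"
    using T' assms(2) unfolding cl_def displayed_triples_def by blast
  have leaves: "leaf_set Z \<subseteq> tree_leaves (fst T)" if "\<forall>t\<in>Z. displays T t" for Z and T :: "'v rooted"
    using displays_leaves[of "fst T" "snd T"] that unfolding leaf_set_def by auto
  have "leaf_set Y \<subseteq> leaf_set X" "leaf_set X \<subseteq> leaf_set Y"
    using leaves[OF TY] leaves[OF TX] T T' unfolding triple_span_def by simp_all
  then show "T \<in> triple_span Y" using T TY unfolding triple_span_def by simp
qed

lemma cl_eqI:
  fixes X Y :: "'v::infinite triple set"
  assumes "consistent X" "consistent Y" "X \<subseteq> cl Y" "Y \<subseteq> cl X"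
  shows "cl X = cl Y"
  using span_antimono_cl[OF assms(2-4)] span_antimono_cl[OF assms(1,4,3)] unfolding cl_def by blast

lemma representative_iff:
  fixes R :: "'v::infinite triple set"
  assumes "consistent R"
  shows "representative S R \<longleftrightarrow> S \<subseteq> R \<and> R \<subseteq> inferred S"
proof (cases "S \<subseteq> R")
  case True
  then have S: "consistent S" using consistent_subset assms by blast
  have "cl S = cl R \<longleftrightarrow> R \<subseteq> cl S"
  proof
    show "R \<subseteq> cl S" if "cl S = cl R" unfolding that by (rule subset_cl)
  next
    assume "R \<subseteq> cl S"
    moreover have "S \<subseteq> cl R" using True subset_cl[of R] by (rule subset_trans)
    ultimately show "cl S = cl R" using cl_eqI[OF S assms] by blast
  qed
  then show ?thesis using True cl_eq_inferred[OF S] unfolding representative_def by simp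
qed (simp add: representative_def)

theorem mainTheorem1:
  fixes R :: "'v::infinite triple set"
  assumes "consistent R"
  shows "matroid R (rep_indep_sets R) \<and> bases (rep_indep_sets R) = min_sc R"
proof -
  obtain T where T: "rooted_tree T" "\<forall>t\<in>R. displays T t"
    using assms unfolding consistent_def by blast
  have disc: "aho_disconnected R" using T by (rule aho_disconnected_displayed)
  have proper: "proper_triples R" unfolding proper_triples_def using T(2) displays_proper by blast
  have cons: "consistent S" if "S \<subseteq> R" for S using consistent_subset[OF assms that] .
  define Gen where "Gen S \<longleftrightarrow> S \<subseteq> R \<and> cl S = cl R" for S
  have Gen_iff: "Gen S \<longleftrightarrow> S \<subseteq> R \<and> R \<subseteq> inferred S" for S
    using representative_iff[OF assms] unfolding Gen_def representative_def .
  interpret generating_exchange R Gen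
  proof
    show "finite R" using assms by (rule consistent_imp_finite)
    show "Gen R" by (simp add: Gen_def)
    show "Gen Y" if "Gen X" "X \<subseteq> Y" "Y \<subseteq> R" for X Y
      using that inferred_mono[OF that(2)] unfolding Gen_iff by blast
  next
    fix X Y b
    assume X: "X \<subseteq> R" and Y: "Y \<subseteq> R" and genX: "Gen X" and genY: "Gen Y" and b: "b \<in> X - Y"
      and not: "\<not> Gen (X - {b})"
    let ?G = "X - {b}"
    have G: "?G \<subseteq> R" using X by blast
    have insb: "insert b ?G = X" using b by blast
    have bR: "b \<in> R" using b X by blast
    then obtain x y z where xyz: "b = ({x, y}, z)" using proper unfolding proper_triples_def by blast
    \<comment> \<open>Since \<open>Z\<close> contains the rest of \<open>X\<close>, inferring
      \<open>b\<close> alone already gives \<open>X \<subseteq> cl Z\<close>.\<close>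
    have generates: "Gen Z" if Z: "?G \<subseteq> Z" "Z \<subseteq> R" "b \<in> inferred Z" for Z
    proof -
      have "Z \<subseteq> cl Z" by (rule subset_cl)
      then have "X \<subseteq> cl Z" using Z insb cl_eq_inferred[OF cons[OF Z(2)]] by blast
      moreover have "Z \<subseteq> cl X" using Z(2) genX subset_cl[of R] unfolding Gen_def by blast
      ultimately have "cl X = cl Z" using cl_eqI[OF cons[OF X] cons[OF Z(2)]] by blast
      then show "Gen Z" using genX Z(2) unfolding Gen_def by simp
    qed
    have bG: "b \<notin> inferred ?G" using generates[OF order_refl G] not by blast
    have "b \<in> inferred Y" using genY bR unfolding Gen_iff by blast
    moreover have "Y \<subseteq> inferred (insert b ?G)" unfolding insb using genX Y unfolding Gen_iff by blast
    ultimately obtain n where n: "n \<in> Y" "b \<in> inferred (insert n ?G)"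
      using inferred_exchange[OF disc G Y, of x y z] bR bG unfolding xyz by blast
    \<comment> \<open>\<open>b\<close> is not in \<open>Y\<close>, so \<open>n\<close> is not
      \<open>b\<close>; any other \<open>n\<close> in \<open>X\<close> would add nothing to
      \<open>?G\<close>, which does not infer \<open>b\<close>.\<close>
    have "n \<notin> X"
    proof
      assume "n \<in> X"
      moreover have "n \<noteq> b" using n(1) b by blast
      ultimately have "insert n ?G = ?G" by blast
      then show False using n(2) bG by simp
    qed
    moreover have "Gen (insert n ?G)" using generates[OF _ _ n(2)] n(1) Y G by blast
    ultimately show "\<exists>n\<in>Y - X. Gen (insert n ?G)" using n(1) by blast
  qed
  have min: "min_sc R = {B. min_gen B}"
    unfolding min_sc_def sc_def representative_def min_gen_def Gen_def by auto
  then have "rep_indep_sets R = {I. \<exists>B. min_gen B \<and> I \<subseteq> B}"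
    unfolding rep_indep_sets_def by blast
  then show ?thesis using matroid_min_gen bases_min_gen min by simp
qed

end
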